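(* For $n\in\mathbb{N}$ let $(U_j^{(n)})_{j\in\mathbb{N}}$ be independent random variables, each uniformly distributed on $[n]=\{1,\dots,n\}$. For $1\le m\le n$ let $\tau^{(n)}(m)$ be the smallest $j$ such that there are exactly $m$ distinct values among $U_1^{(n)},\dots,U_j^{(n)}$, set $\tau^{(n)}(m):=\tau^{(n)}(n)$ for $m>n$, and let $B_n(m):=\{U_1^{(n)},\dots,U_{\tau^{(n)}(m)}^{(n)}\}$. Let $(\mathcal{G}_k(p))_{k\in\mathbb{N},\,p\ \text{prime}}$ be independent with $\mathbb{P}\{\mathcal{G}_k(p)\ge j\}=p^{-j}$ for $j\in\mathbb{N}_0$, and let $(U_j)_{j\ge1}$ be independent uniform on $[0,1]$, independent of the $\mathcal{G}_k(p)$. Then, as $n\to\infty$, $$\Bigl(\log{\rm lcm}(B_n(m))-m\log n\Bigr)_{m\in\mathbb{N}}$$ converges in distribution in $\mathbb{R}^\infty$ with the product topology to $$\Bigl(\sum_{j=1}^m\log U_j+\sum_{p\ \text{prime}}\log p\cdot\Bigl(\max_{1\le k\le m}\mathcal{G}_k(p)-\sum_{k=1}^m\mathcal{G}_k(p)\Bigr)\Bigr)_{m\in\mathbb{N}}.$$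
   Context: ${\rm lcm}$ denotes least common multiple. For each $m\le n$, $B_n(m)$ is a uniformly random $m$-element subset of $[n]$. *)

theory Defs
  imports "HOL-Probability.Probability"
begin

definition conv_in_distr ::
  "(nat \<Rightarrow> 'a::topological_space measure) \<Rightarrow> 'a measure \<Rightarrow> bool" where
  "conv_in_distr Ms M \<longleftrightarrow>
     (\<forall>f :: 'a \<Rightarrow> real. continuous_on UNIV f \<and> bounded (range f) \<longrightarrow>
        (\<lambda>n. integral\<^sup>L (Ms n) f) \<longlonglongrightarrow> integral\<^sup>L M f)"

text \<open>Probability space for fixed n: the sequence (U_j)_{j>=1} of i.i.d. uniform
variables on [n] = {1..n}, realised as the coordinates of omega (omega 0 unused).\<close>
definition U_space :: "nat \<Rightarrow> (nat \<Rightarrow> nat) measure" where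
  "U_space n = (\<Pi>\<^sub>M j\<in>(UNIV::nat set). measure_pmf (pmf_of_set {1..n}))"

text \<open>tau^(n)(m): the smallest j such that U_1..U_j take exactly m distinct values
(for m > n this is tau^(n)(n), hence the min).\<close>
definition tau :: "nat \<Rightarrow> nat \<Rightarrow> (nat \<Rightarrow> nat) \<Rightarrow> nat" where
  "tau n m \<omega> = (LEAST j. card (\<omega> ` {1..j}) = min m n)"

definition B :: "nat \<Rightarrow> nat \<Rightarrow> (nat \<Rightarrow> nat) \<Rightarrow> nat set" where
  "B n m \<omega> = \<omega> ` {1..tau n m \<omega>}"

definition X :: "nat \<Rightarrow> (nat \<Rightarrow> nat) \<Rightarrow> (nat \<Rightarrow> real)" where
  "X n \<omega> = (\<lambda>i. let m = Suc i in ln (real (Lcm (B n m \<omega>))) - real m * ln (real n))"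

text \<open>Limit space: independent G_k(p) (k, p indices; geometric with
P(G >= j) = p^(-j) for p prime; dummy constant 0 for non-prime p) and,
independently, i.i.d. uniform U_j on [0,1].\<close>
definition G_space :: "(nat \<times> nat \<Rightarrow> nat) measure" where
  "G_space = (\<Pi>\<^sub>M kp\<in>(UNIV::(nat \<times> nat) set).
      measure_pmf (if prime (snd kp) then geometric_pmf (1 - 1 / real (snd kp)) else return_pmf 0))"

definition Unif_space :: "(nat \<Rightarrow> real) measure" where
  "Unif_space = (\<Pi>\<^sub>M j\<in>(UNIV::nat set). uniform_measure lborel {0..1::real})"

definition lim_space :: "((nat \<times> nat \<Rightarrow> nat) \<times> (nat \<Rightarrow> real)) measure" where
  "lim_space = G_space \<Otimes>\<^sub>M Unif_space"

definition Y :: "(nat \<times> nat \<Rightarrow> nat) \<times> (nat \<Rightarrow> real) \<Rightarrow> (nat \<Rightarrow> real)" where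
  "Y \<omega> = (\<lambda>i. let m = Suc i; G = fst \<omega>; U = snd \<omega> in
      (\<Sum>j=1..m. ln (U j)) +
      (\<Sum>\<^sub>\<infinity> p\<in>{p::nat. prime p}.
          ln (real p) * (real (Max ((\<lambda>k. G (k, p)) ` {1..m})) - real (\<Sum>k=1..m. G (k, p)))))"

end

theory Submission
  imports Defs
begin

text \<open>
  With probability tending to 1 the first \<open>m\<close> values \<open>u_1,\<dots>,u_m\<close> are distinct, and then
  \<open>log lcm(B_n(m)) - m log n = \<Sum>\<^sub>k log (u_k / n) + \<Sum>\<^sub>p log p (max_k v_p(u_k) - \<Sum>\<^sub>k v_p(u_k))\<close>,
  which is the limiting functional evaluated at the ratios \<open>u_k / n\<close> and the \<open>p\<close>-adic valuations.
  A prime \<open>p\<close> contributes only if it divides two of the numbers, which has probability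
  \<open>O(p^-2)\<close> uniformly in \<open>n\<close>; so up to an event of uniformly small probability only primes
  \<open>p \<le> N\<close> and valuations at most \<open>N\<close> matter, and the ratios may be rounded up to multiples of
  \<open>1 / N^2\<close>.  The rounded functional depends on finitely many events, and expectations of such
  functionals converge because the probabilities of intersections do: these are products of terms
  \<open>\<lfloor>\<lfloor>b n\<rfloor> / d\<rfloor> / n\<close>, which tend to \<open>b / d\<close>.
  In the infinite product it is enough to test bounded functions that are Lipschitz in finitely many
  coordinates, since every nonnegative continuous function is the increasing limit of its
  inf-convolutions with multiples of partial \<open>l^1\<close> distances.
\<close>

section \<open>Weak convergence in the product topology\<close>

text \<open>The inf-convolution of \<open>f\<close> with a partial \<open>l^1\<close> distance. The
  single parameter \<open>N\<close> is both the slope and the number of coordinates, so one limit in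
  \<open>N\<close> exhausts all coordinates and lets the penalty grow.\<close>

definition lip_reg :: "((nat \<Rightarrow> real) \<Rightarrow> real) \<Rightarrow> nat \<Rightarrow> (nat \<Rightarrow> real) \<Rightarrow> real" where
  "lip_reg f N x = (INF y. f y + real N * (\<Sum>i<N. \<bar>x i - y i\<bar>))"

lemma lip_reg_bdd_below:
  assumes "\<And>x. 0 \<le> f x"
  shows "bdd_below (range (\<lambda>y. f y + real N * (\<Sum>i<N. \<bar>x i - y i\<bar>)))"
  by (rule bdd_belowI[of _ 0]) (auto intro!: add_nonneg_nonneg assms mult_nonneg_nonneg sum_nonneg)

lemma lip_reg_le:
  assumes "\<And>x. 0 \<le> f x"
  shows "lip_reg f N x \<le> f y + real N * (\<Sum>i<N. \<bar>x i - y i\<bar>)"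
  unfolding lip_reg_def by (rule cINF_lower[OF lip_reg_bdd_below[of f, OF assms]]) auto

lemma lip_reg_nonneg:
  assumes "\<And>x. 0 \<le> f x"
  shows "0 \<le> lip_reg f N x"
  unfolding lip_reg_def by (rule cINF_greatest) (auto intro!: add_nonneg_nonneg assms mult_nonneg_nonneg sum_nonneg)

lemma lip_reg_le_self:
  assumes "\<And>x. 0 \<le> f x"
  shows "lip_reg f N x \<le> f x"
  using lip_reg_le[of f N x x, OF assms] by simp

text \<open>By the triangle inequality every function under the infimum changes by at most the
  right-hand side when \<open>x\<close> moves to \<open>y\<close>, and this bound survives the
  infimum.\<close>

lemma lip_reg_lipschitz:
  assumes f: "\<And>x. 0 \<le> f x"
  shows "\<bar>lip_reg f N x - lip_reg f N y\<bar> \<le> real N * (\<Sum>i<N. \<bar>x i - y i\<bar>)"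
proof -
  have *: "lip_reg f N x - real N * (\<Sum>i<N. \<bar>x i - y i\<bar>) \<le> lip_reg f N y" for x y
  proof -
    have "lip_reg f N x - real N * (\<Sum>i<N. \<bar>x i - y i\<bar>) \<le> f z + real N * (\<Sum>i<N. \<bar>y i - z i\<bar>)" for z
    proof -
      have "(\<Sum>i<N. \<bar>x i - z i\<bar>) \<le> (\<Sum>i<N. \<bar>x i - y i\<bar>) + (\<Sum>i<N. \<bar>y i - z i\<bar>)"
        unfolding sum.distrib[symmetric] by (intro sum_mono) linarith
      then have "real N * (\<Sum>i<N. \<bar>x i - z i\<bar>) \<le> real N * (\<Sum>i<N. \<bar>x i - y i\<bar>) + real N * (\<Sum>i<N. \<bar>y i - z i\<bar>)"
        by (metis distrib_left mult_left_mono of_nat_0_le_iff)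
      then show ?thesis using lip_reg_le[of f N x z, OF f] by linarith
    qed
    then show ?thesis unfolding lip_reg_def[of f N y] by (intro cINF_greatest) auto
  qed
  have "(\<Sum>i<N. \<bar>x i - y i\<bar>) = (\<Sum>i<N. \<bar>y i - x i\<bar>)" by (intro sum.cong) auto
  with *[of x y] *[of y x] show ?thesis by (simp add: abs_le_iff)
qed

lemma tendsto_coordinatewise:
  fixes y :: "'b \<Rightarrow> 'i \<Rightarrow> 'a::topological_space"
  assumes "\<And>i. ((\<lambda>n. y n i) \<longlongrightarrow> x i) F"
  shows "(y \<longlongrightarrow> x) F"
  using limitin_componentwise[of "\<lambda>_. euclidean" UNIV y x F] assms
  by (simp add: euclidean_product_topology)

text \<open>A near-minimizer \<open>y N\<close> pays \<open>N\<close> times its partial distance to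
  \<open>x\<close> but its total cost is at most \<open>f x + 1\<close>. Hence \<open>y N\<close>
  tends to \<open>x\<close> coordinatewise, and continuity of \<open>f\<close> along
  \<open>y N\<close> gives the lower bound that matches \<open>lip_reg_le_self\<close>.\<close>

lemma lip_reg_tendsto:
  fixes f :: "(nat \<Rightarrow> real) \<Rightarrow> real"
  assumes f: "\<And>x. 0 \<le> f x" and c: "continuous_on UNIV f"
  shows "(\<lambda>N. lip_reg f N x) \<longlonglongrightarrow> f x"
proof -
  \<comment> \<open>The slack is \<open>1 / real (Suc N)\<close> so that it is positive for
    \<open>N = 0\<close> too.\<close>
  have "\<exists>y. f y + real N * (\<Sum>i<N. \<bar>x i - y i\<bar>) < lip_reg f N x + 1 / real (Suc N)" for N
  proof -
    have "lip_reg f N x < lip_reg f N x + 1 / real (Suc N)" by simp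
    then show ?thesis
      using cINF_less_iff[OF UNIV_not_empty lip_reg_bdd_below[of f N x, OF f]]
      unfolding lip_reg_def[of f N x] by blast
  qed
  then obtain y where y: "\<And>N. f (y N) + real N * (\<Sum>i<N. \<bar>x i - y N i\<bar>) < lip_reg f N x + 1 / real (Suc N)"
    by metis
  have "(\<lambda>N. y N i) \<longlonglongrightarrow> x i" for i
  proof (rule LIM_zero_cancel, rule tendsto_rabs_zero_cancel, rule tendsto_sandwich[of "\<lambda>_. 0"])
    show "\<forall>\<^sub>F N in sequentially. \<bar>y N i - x i\<bar> \<le> (f x + 1) * (1 / real N)"
    \<comment> \<open>Coordinate \<open>i\<close> enters the partial distance only once
      \<open>i < N\<close>.\<close>
    proof (rule eventually_sequentiallyI[of "Suc i"])
      fix N assume N: "Suc i \<le> N"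
      have "\<bar>y N i - x i\<bar> \<le> (\<Sum>i<N. \<bar>x i - y N i\<bar>)"
        using N member_le_sum[of i "{..<N}" "\<lambda>i. \<bar>x i - y N i\<bar>"] by auto
      then have "real N * \<bar>y N i - x i\<bar> \<le> real N * (\<Sum>i<N. \<bar>x i - y N i\<bar>)"
        by (intro mult_left_mono) auto
      also have "\<dots> \<le> f x + 1"
      proof -
        have "1 / real (Suc N) \<le> 1" by simp
        then show ?thesis using y[of N] f[of "y N"] lip_reg_le_self[of f N x, OF f] by linarith
      qed
      finally show "\<bar>y N i - x i\<bar> \<le> (f x + 1) * (1 / real N)" using N by (simp add: field_simps)
    qed
    show "(\<lambda>N. (f x + 1) * (1 / real N)) \<longlonglongrightarrow> 0"
      using tendsto_mult_right[OF lim_1_over_n, of "f x + 1"] by simp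
  qed auto
  then have "y \<longlonglongrightarrow> x" by (rule tendsto_coordinatewise)
  then have "(\<lambda>N. f (y N)) \<longlonglongrightarrow> f x"
    by (rule continuous_on_tendsto_compose[OF c]) auto
  then have "(\<lambda>N. f (y N) - 1 / real (Suc N)) \<longlonglongrightarrow> f x"
    using tendsto_diff[OF _ LIMSEQ_Suc[OF lim_1_over_n], of "\<lambda>N. f (y N)" "f x"] by simp
  then show ?thesis
  proof (rule tendsto_sandwich[rotated 2, where h="\<lambda>_. f x"])
    show "\<forall>\<^sub>F N in sequentially. f (y N) - 1 / real (Suc N) \<le> lip_reg f N x"
    proof (rule always_eventually, rule)
      fix N
      have "0 \<le> real N * (\<Sum>i<N. \<bar>x i - y N i\<bar>)" by (intro mult_nonneg_nonneg sum_nonneg) auto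
      then show "f (y N) - 1 / real (Suc N) \<le> lip_reg f N x" using y[of N] by linarith
    qed
  qed (auto simp: lip_reg_le_self[of f, OF f])
qed

lemma coordinate_lipschitz_continuous:
  fixes h :: "(nat \<Rightarrow> real) \<Rightarrow> real"
  assumes "\<And>x y. \<bar>h x - h y\<bar> \<le> L * (\<Sum>i<N. \<bar>x i - y i\<bar>)"
  shows "continuous_on UNIV h"
  unfolding continuous_on_def
proof safe
  fix x
  have "((\<lambda>y. \<bar>h y - h x\<bar>) \<longlongrightarrow> 0) (at x)"
  proof (rule tendsto_sandwich[of "\<lambda>_. 0"])
    show "((\<lambda>y. L * (\<Sum>i<N. \<bar>y i - x i\<bar>)) \<longlongrightarrow> 0) (at x)"
    proof -
      have "continuous_on UNIV (\<lambda>y. L * (\<Sum>i<N. \<bar>y i - x i\<bar>))"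
        by (intro continuous_on_mult continuous_on_sum continuous_on_rabs continuous_on_diff
            continuous_on_const continuous_on_product_coordinates)
      then show ?thesis unfolding continuous_on_def by (auto dest!: spec[of _ x])
    qed
  qed (use assms in auto)
  then show "(h \<longlongrightarrow> h x) (at x within UNIV)"
    by (rule LIM_zero_cancel[OF tendsto_rabs_zero_cancel])
qed

text \<open>The regularizations approximate a bounded nonnegative continuous function from below,
  and they are admissible test functions. This bounds the limit inferior of its integrals; applied
  to \<open>f + C\<close> and to \<open>C - f\<close> it gives convergence.\<close>

proposition conv_in_distrI_lipschitz:
  fixes Ms :: "nat \<Rightarrow> (nat \<Rightarrow> real) measure"
  assumes Ms: "\<And>n. prob_space (Ms n)" "\<And>n. sets (Ms n) = sets borel"
    and M: "prob_space M" "sets M = sets borel"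
    and conv: "\<And>h L N C. (\<And>x y. \<bar>h x - h y\<bar> \<le> L * (\<Sum>i<N. \<bar>x i - y i\<bar>)) \<Longrightarrow>
       0 \<le> L \<Longrightarrow> (\<And>x. \<bar>h x\<bar> \<le> C) \<Longrightarrow> (\<lambda>n. integral\<^sup>L (Ms n) h) \<longlonglongrightarrow> integral\<^sup>L M h"
  shows "conv_in_distr Ms M"
proof -
  have int: "integrable K f" if "prob_space K" "sets K = sets borel" "continuous_on UNIV f" "\<And>x. \<bar>f x\<bar> \<le> C"
    for K and f :: "(nat \<Rightarrow> real) \<Rightarrow> real" and C
  proof -
    interpret prob_space K by fact
    have "f \<in> borel_measurable K"
      using borel_measurable_continuous_onI[OF that(3)] measurable_cong_sets[OF that(2) refl] by blast
    then show ?thesis by (intro integrable_const_bound[of _ C]) (use that in auto)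
  qed
  \<comment> \<open>Dominated convergence under \<open>M\<close> picks an \<open>N\<close> losing
    less than \<open>e\<close>; the hypothesis on test functions is then used for this one
    \<open>N\<close>. Since \<open>lip_reg f N\<close> lies below \<open>f\<close>, the bound is
    one-sided.\<close>
  have lower: "\<forall>\<^sub>F n in sequentially. integral\<^sup>L M f - e < integral\<^sup>L (Ms n) f"
    if f: "continuous_on UNIV f" "\<And>x. 0 \<le> f x" "\<And>x. f x \<le> C" and e: "e > 0" 
    for f :: "(nat \<Rightarrow> real) \<Rightarrow> real" and C e
  proof -
    have bnd: "\<bar>lip_reg f N x\<bar> \<le> C" for N x
      using lip_reg_nonneg[of f N x] lip_reg_le_self[of f N x] f(2,3) by (smt (verit))
    have ct: "continuous_on UNIV (lip_reg f N)" for N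
      by (rule coordinate_lipschitz_continuous) (rule lip_reg_lipschitz[of f, OF f(2)])
    note lint = int[OF _ _ ct bnd]
    have "(\<lambda>N. integral\<^sup>L M (lip_reg f N)) \<longlonglongrightarrow> integral\<^sup>L M f"
    proof (rule integral_dominated_convergence[where w="\<lambda>_. C"])
      interpret prob_space M by fact
      show "integrable M (\<lambda>_. C)" by simp
      have "integrable M f" using f by (intro int[OF M, of f C]) auto
      then show "f \<in> borel_measurable M" by auto
      show "lip_reg f N \<in> borel_measurable M" for N using lint[OF M] by auto
    qed (use bnd lip_reg_tendsto[of f, OF f(2,1)] in auto)
    from order_tendstoD(1)[OF this, of "integral\<^sup>L M f - e"] e
    obtain N where N: "integral\<^sup>L M f - e < integral\<^sup>L M (lip_reg f N)"
      by (auto simp: eventually_sequentially)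
    have "(\<lambda>n. integral\<^sup>L (Ms n) (lip_reg f N)) \<longlonglongrightarrow> integral\<^sup>L M (lip_reg f N)"
      by (rule conv[OF lip_reg_lipschitz[of f, OF f(2)] _ bnd]) auto
    from order_tendstoD(1)[OF this N] show ?thesis
    proof eventually_elim
      case (elim n)
      have "integral\<^sup>L (Ms n) (lip_reg f N) \<le> integral\<^sup>L (Ms n) f"
        using f by (intro integral_mono lint[OF Ms] int[OF Ms, of f C] lip_reg_le_self) auto
      with elim show ?case by simp
    qed
  qed
  show ?thesis unfolding conv_in_distr_def
  proof safe
    fix f :: "(nat \<Rightarrow> real) \<Rightarrow> real"
    assume c: "continuous_on UNIV f" and "bounded (range f)"
    then obtain C where C: "\<And>x. \<bar>f x\<bar> \<le> C" by (auto simp: bounded_iff)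
    have C': "- C \<le> f x" "f x \<le> C" for x using C[of x] by linarith+
    have ints: "integral\<^sup>L K (\<lambda>x. f x + C) = integral\<^sup>L K f + C"
      "integral\<^sup>L K (\<lambda>x. C - f x) = C - integral\<^sup>L K f" if "prob_space K" "sets K = sets borel" for K
    proof -
      interpret prob_space K by fact
      show "integral\<^sup>L K (\<lambda>x. f x + C) = integral\<^sup>L K f + C" "integral\<^sup>L K (\<lambda>x. C - f x) = C - integral\<^sup>L K f"
        using int[OF that c C] by (simp_all add: prob_space)
    qed
    show "(\<lambda>n. integral\<^sup>L (Ms n) f) \<longlonglongrightarrow> integral\<^sup>L M f"
    \<comment> \<open>Both \<open>f + C\<close> and \<open>C - f\<close> take values between
      \<open>0\<close> and \<open>2 * C\<close>: the first yields the lower bound, the second the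
      upper one.\<close>
    proof (rule order_tendstoI)
      fix a assume "a < integral\<^sup>L M f"
      then have "\<forall>\<^sub>F n in sequentially. integral\<^sup>L M (\<lambda>x. f x + C) - (integral\<^sup>L M f - a) < integral\<^sup>L (Ms n) (\<lambda>x. f x + C)"
        using C' by (intro lower[where C="2 * C"] continuous_intros c) (auto simp: algebra_simps neg_le_iff_le, smt (verit))
      then show "\<forall>\<^sub>F n in sequentially. a < integral\<^sup>L (Ms n) f"
        using ints(1)[OF Ms] ints(1)[OF M] by simp
    next
      fix a assume "integral\<^sup>L M f < a"
      then have "\<forall>\<^sub>F n in sequentially. integral\<^sup>L M (\<lambda>x. C - f x) - (a - integral\<^sup>L M f) < integral\<^sup>L (Ms n) (\<lambda>x. C - f x)"
        using C' by (intro lower[where C="2 * C"] continuous_intros c) (auto simp: algebra_simps, smt (verit))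
      then show "\<forall>\<^sub>F n in sequentially. integral\<^sup>L (Ms n) f < a"
        using ints(2)[OF Ms] ints(2)[OF M] by simp
    qed
  qed
qed

section \<open>Functionals of finitely many events\<close>

text \<open>Moebius inversion on the lattice of subsets, by induction on \<open>I\<close>: adding a
  new element \<open>i\<close> changes \<open>g\<close> by a function of subsets of the smaller set,
  which has an expansion of its own.\<close>

lemma subset_sum_representation:
  fixes g :: "'i set \<Rightarrow> real"
  assumes "finite I"
  shows "\<exists>c. \<forall>S\<subseteq>I. g S = (\<Sum>J\<in>Pow S. c J)"
  using assms
proof (induction I arbitrary: g rule: finite_induct)
  case empty
  show ?case by (rule exI[of _ g]) auto
next
  case (insert i I)
  obtain c where c: "\<And>S. S \<subseteq> I \<Longrightarrow> g S = (\<Sum>J\<in>Pow S. c J)"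
    using insert.IH[of g] by auto
  obtain d where d: "\<And>S. S \<subseteq> I \<Longrightarrow> g (insert i S) - g S = (\<Sum>J\<in>Pow S. d J)"
    using insert.IH[of "\<lambda>S. g (insert i S) - g S"] by auto
  \<comment> \<open>Sets containing \<open>i\<close> carry the coefficients of the increment, all
    others those of \<open>g\<close> on the old subsets.\<close>
  let ?e = "\<lambda>J. if i \<in> J then d (J - {i}) else c J"
  have e: "g S = (\<Sum>J\<in>Pow S. ?e J)" if "S \<subseteq> I" for S
    unfolding c[OF that] using insert.hyps that by (intro sum.cong) auto
  have "g S = (\<Sum>J\<in>Pow S. ?e J)" if S: "S \<subseteq> insert i I" "i \<in> S" for S
  proof -
    define T where "T = S - {i}"
    have T: "T \<subseteq> I" "i \<notin> T" "S = insert i T" "finite T"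
      using S insert.hyps finite_subset[of T I] by (auto simp: T_def)
    have inj: "inj_on (insert i) (Pow T)" using T by (auto simp: inj_on_def)
    have "(\<Sum>J\<in>Pow S. ?e J) = (\<Sum>J\<in>Pow T. ?e J) + (\<Sum>J\<in>insert i ` Pow T. ?e J)"
      unfolding T(3) Pow_insert using T by (intro sum.union_disjoint) auto
    also have "(\<Sum>J\<in>insert i ` Pow T. ?e J) = (\<Sum>J\<in>Pow T. ?e (insert i J))"
      by (simp add: sum.reindex[OF inj])
    also have "\<dots> = (\<Sum>J\<in>Pow T. d J)" using T by (intro sum.cong) (auto intro!: arg_cong[of _ _ d])
    finally show ?thesis using e[OF T(1)] d[OF T(1)] T(3) by simp
  qed
  then have "\<forall>S\<subseteq>insert i I. g S = (\<Sum>J\<in>Pow S. ?e J)" using e by (metis subset_insert)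
  then show ?case by blast
qed

text \<open>All events in \<open>J\<close> occur exactly when \<open>J\<close> is a subset of the
  set of occurring events, so the expansion of \<open>g\<close> becomes a linear combination of
  indicators of intersections. The coefficients are a parameter so that one choice can serve many
  probability spaces.\<close>

lemma expectation_finite_events:
  fixes g :: "'i set \<Rightarrow> real"
  assumes "prob_space P" and I: "finite I" and E: "\<And>i. i \<in> I \<Longrightarrow> {\<omega>\<in>space P. E i \<omega>} \<in> sets P"
    and c: "\<And>S. S \<subseteq> I \<Longrightarrow> g S = (\<Sum>J\<in>Pow S. c J)"
  shows "integrable P (\<lambda>\<omega>. g {i\<in>I. E i \<omega>})"
    and "integral\<^sup>L P (\<lambda>\<omega>. g {i\<in>I. E i \<omega>}) = (\<Sum>J\<in>Pow I. c J * measure P {\<omega>\<in>space P. \<forall>i\<in>J. E i \<omega>})"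
proof -
  interpret prob_space P by fact
  have eq: "g {i\<in>I. E i \<omega>} = (\<Sum>J\<in>Pow I. c J * indicat_real {\<omega>\<in>space P. \<forall>i\<in>J. E i \<omega>} \<omega>)" if "\<omega> \<in> space P" for \<omega>
  proof -
    have "g {i\<in>I. E i \<omega>} = (\<Sum>J\<in>Pow {i\<in>I. E i \<omega>}. c J)" by (intro c) auto
    also have "\<dots> = (\<Sum>J\<in>Pow I. c J * indicat_real {\<omega>\<in>space P. \<forall>i\<in>J. E i \<omega>} \<omega>)"
      using that I by (intro sum.mono_neutral_cong_left) (auto simp: indicator_def)
    finally show ?thesis .
  qed
  have ev: "{\<omega>\<in>space P. \<forall>i\<in>J. E i \<omega>} \<in> sets P" if "J \<in> Pow I" for J
    using that I E by (intro sets.sets_Collect_finite_All) (auto intro: finite_subset)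
  have int: "integrable P (\<lambda>\<omega>. c J * indicat_real {\<omega>\<in>space P. \<forall>i\<in>J. E i \<omega>} \<omega>)" if "J \<in> Pow I" for J
    using ev[OF that] by (intro integrable_mult_right integrable_real_indicator) (auto simp: emeasure_eq_measure)
  show "integrable P (\<lambda>\<omega>. g {i\<in>I. E i \<omega>})"
    using int by (subst Bochner_Integration.integrable_cong[OF refl eq]) auto
  show "integral\<^sup>L P (\<lambda>\<omega>. g {i\<in>I. E i \<omega>}) = (\<Sum>J\<in>Pow I. c J * measure P {\<omega>\<in>space P. \<forall>i\<in>J. E i \<omega>})"
    using int ev by (subst Bochner_Integration.integral_cong[OF refl eq])
      (auto simp: Int_absorb2 intro!: sum.cong)
qed

lemma expectation_finite_events_tendsto:
  fixes g :: "'i set \<Rightarrow> real"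
  assumes Ps: "\<And>n::nat. prob_space (Ps n)" "\<And>n i. i \<in> I \<Longrightarrow> {\<omega>\<in>space (Ps n). Es n i \<omega>} \<in> sets (Ps n)"
    and P: "prob_space P" "\<And>i. i \<in> I \<Longrightarrow> {\<omega>\<in>space P. E i \<omega>} \<in> sets P"
    and I: "finite I"
    and lim: "\<And>J. J \<subseteq> I \<Longrightarrow> (\<lambda>n. measure (Ps n) {\<omega>\<in>space (Ps n). \<forall>i\<in>J. Es n i \<omega>}) \<longlonglongrightarrow> measure P {\<omega>\<in>space P. \<forall>i\<in>J. E i \<omega>}"
  shows "(\<lambda>n. integral\<^sup>L (Ps n) (\<lambda>\<omega>. g {i\<in>I. Es n i \<omega>})) \<longlonglongrightarrow> integral\<^sup>L P (\<lambda>\<omega>. g {i\<in>I. E i \<omega>})"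
proof -
  obtain c where c: "\<And>S. S \<subseteq> I \<Longrightarrow> g S = (\<Sum>J\<in>Pow S. c J)"
    using subset_sum_representation[OF I, of g] by auto
  show ?thesis
    using expectation_finite_events(2)[OF Ps(1) I Ps(2), where g=g and c=c]
      expectation_finite_events(2)[OF P(1) I P(2), where g=g and c=c] c
    by (simp, intro tendsto_sum tendsto_mult tendsto_const lim) auto
qed

section \<open>The limiting functional and its truncation\<close>

text \<open>The common shape of prelimit and limit: at the uniform and geometric variables it is
  \<open>Y\<close>, at the ratios and valuations of distinct draws it is \<open>X n\<close>. As in
  \<open>X\<close> and \<open>Y\<close>, index \<open>i\<close> stands for
  \<open>m = Suc i\<close>.\<close>

definition arith_functional :: "(nat \<Rightarrow> real) \<Rightarrow> (nat \<Rightarrow> nat \<Rightarrow> nat) \<Rightarrow> nat \<Rightarrow> real" where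
  "arith_functional x v i = (\<Sum>k=1..Suc i. ln (x k)) + (\<Sum>\<^sub>\<infinity>p\<in>{p. prime p}.
     ln (real p) * (real (Max ((\<lambda>k. v k p) ` {1..Suc i})) - real (\<Sum>k=1..Suc i. v k p)))"

lemma Y_eq_arith_functional: "Y \<omega> = arith_functional (snd \<omega>) (\<lambda>k p. fst \<omega> (k, p))"
  by (simp add: Y_def arith_functional_def Let_def fun_eq_iff)

section \<open>Prime factorization of the least common multiple\<close>

lemma infsum_finite_support:
  fixes f :: "'a \<Rightarrow> real"
  assumes "finite S" "S \<subseteq> T" "\<And>x. x \<in> T - S \<Longrightarrow> f x = 0"
  shows "infsum f T = sum f S"
  using infsum_cong_neutral[of S T f f] assms by auto

lemma ln_eq_sum_multiplicity:
  assumes "0 < (a::nat)" "finite S" "prime_factors a \<subseteq> S" "\<And>p. p \<in> S \<Longrightarrow> prime p"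
  shows "ln (real a) = (\<Sum>p\<in>S. ln (real p) * real (multiplicity p a))"
proof -
  have "real a = (\<Prod>p\<in>prime_factors a. real p ^ multiplicity p a)"
    by (subst prime_factorization_nat[OF assms(1)]) simp
  also have "ln \<dots> = (\<Sum>p\<in>prime_factors a. ln (real p ^ multiplicity p a))"
    by (intro ln_prod) (auto dest: in_prime_factors_imp_prime simp: prime_gt_0_nat)
  also have "\<dots> = (\<Sum>p\<in>prime_factors a. ln (real p) * real (multiplicity p a))"
    by (intro sum.cong refl) (auto dest: in_prime_factors_imp_prime simp: ln_realpow prime_gt_0_nat)
  also have "\<dots> = (\<Sum>p\<in>S. ln (real p) * real (multiplicity p a))"
    using assms by (intro sum.mono_neutral_left) (auto simp: prime_factors_multiplicity)
  finally show ?thesis .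
qed

lemma Lcm_pos_nat: "finite A \<Longrightarrow> (0::nat) \<notin> A \<Longrightarrow> 0 < Lcm A"
  by (metis Lcm_0_iff_nat gr0I)

lemma multiplicity_Lcm:
  assumes "prime p" "finite A" "A \<noteq> {}" "(0::nat) \<notin> A"
  shows "multiplicity p (Lcm A) = Max (multiplicity p ` A)"
  using assms(2,3,4,1)
proof (induction A rule: finite_ne_induct)
  case (insert a A)
  then have "Lcm A \<noteq> 0" using Lcm_pos_nat[of A] by auto
  with insert show ?case by (simp add: multiplicity_lcm)
qed simp

text \<open>Over the primes dividing the lcm, the logarithm of the lcm has the maximal exponents and
  the logarithm of the product has the summed ones. Adding and subtracting the latter gives the
  identity, and the terms \<open>ln (real n)\<close> are absorbed by the ratios.\<close>

lemma ln_Lcm_eq_arith_functional: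
  assumes n: "n > 0" and u: "\<And>k. k \<in> {1..Suc i} \<Longrightarrow> 0 < u k"
  shows "ln (real (Lcm (u ` {1..Suc i}))) - real (Suc i) * ln (real n)
    = arith_functional (\<lambda>k. real (u k) / real n) (\<lambda>k p. multiplicity p (u k)) i"
proof -
  let ?A = "u ` {1..Suc i}" and ?K = "{1..Suc i}"
  have 0: "0 \<notin> ?A" using u by force
  have pos: "Lcm ?A > 0" using 0 by (intro Lcm_pos_nat) auto
  define S where "S = prime_factors (Lcm ?A)"
  have S: "finite S" "S \<subseteq> {p. prime p}" by (auto simp: S_def dest: in_prime_factors_imp_prime)
  have sub: "prime_factors (u k) \<subseteq> S" if "k \<in> ?K" for k
    unfolding S_def using pos that by (intro dvd_prime_factors) auto
  have 2: "(\<Sum>k\<in>?K. ln (real (u k) / real n)) = (\<Sum>k\<in>?K. ln (real (u k))) - real (Suc i) * ln (real n)"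
  proof -
    have "(\<Sum>k\<in>?K. ln (real (u k) / real n)) = (\<Sum>k\<in>?K. ln (real (u k)) - ln (real n))"
      using u n by (intro sum.cong refl) (simp add: ln_div)
    then show ?thesis by (simp add: sum_subtractf)
  qed
  have 3: "(\<Sum>k\<in>?K. ln (real (u k))) = (\<Sum>p\<in>S. ln (real p) * real (\<Sum>k\<in>?K. multiplicity p (u k)))"
  proof -
    have "(\<Sum>k\<in>?K. ln (real (u k))) = (\<Sum>k\<in>?K. \<Sum>p\<in>S. ln (real p) * real (multiplicity p (u k)))"
      using u sub S by (intro sum.cong refl ln_eq_sum_multiplicity) auto
    also have "\<dots> = (\<Sum>p\<in>S. \<Sum>k\<in>?K. ln (real p) * real (multiplicity p (u k)))" by (rule sum.swap)
    finally show ?thesis by (simp only: sum_distrib_left of_nat_sum)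
  qed
  have 4: "ln (real (Lcm ?A)) = (\<Sum>p\<in>S. ln (real p) * real (Max ((\<lambda>k. multiplicity p (u k)) ` ?K)))"
  proof -
    have "ln (real (Lcm ?A)) = (\<Sum>p\<in>S. ln (real p) * real (multiplicity p (Lcm ?A)))"
      using pos S by (intro ln_eq_sum_multiplicity) (auto simp: S_def)
    then show ?thesis using 0 S multiplicity_Lcm[of _ ?A] by (simp add: image_image subset_iff)
  qed
  have 5: "(\<Sum>\<^sub>\<infinity>p\<in>{p. prime p}. ln (real p) *
      (real (Max ((\<lambda>k. multiplicity p (u k)) ` ?K)) - real (\<Sum>k\<in>?K. multiplicity p (u k)))) =
    (\<Sum>p\<in>S. ln (real p) * (real (Max ((\<lambda>k. multiplicity p (u k)) ` ?K)) - real (\<Sum>k\<in>?K. multiplicity p (u k))))"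
  proof (rule infsum_finite_support[OF S])
    fix p assume "p \<in> {p. prime p} - S"
    then have p: "prime p" "p \<notin> S" by auto
    have "multiplicity p (u k) = 0" if "k \<in> ?K" for k
      using p sub[OF that] u[OF that] by (auto simp: prime_factors_multiplicity)
    then have "(\<lambda>k. multiplicity p (u k)) ` ?K = {0}" "(\<Sum>k\<in>?K. multiplicity p (u k)) = 0"
      by (auto simp: image_def)
    then show "ln (real p) * (real (Max ((\<lambda>k. multiplicity p (u k)) ` ?K)) - real (\<Sum>k\<in>?K. multiplicity p (u k))) = 0"
      by (simp only: Max_singleton) simp
  qed
  show ?thesis unfolding arith_functional_def 2 3 4 5
    by (simp only: right_diff_distrib sum_subtractf)
qed

text \<open>Both sides take the junk value 0 when \<open>f\<close> is not summable.\<close>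
lemma infsum_eq_integral_count_space:
  fixes f :: "'a \<Rightarrow> real"
  shows "infsum f A = integral\<^sup>L (count_space A) f"
proof (cases "Infinite_Set_Sum.abs_summable_on f A")
  case True
  then show ?thesis using infsetsum_infsum[OF True] by (simp add: infsetsum_def)
next
  case False
  then have "\<not> f summable_on A"
    using abs_summable_equivalent summable_on_iff_abs_summable_on_real by blast
  moreover have "\<not> integrable (count_space A) f"
    using False by (simp add: Infinite_Set_Sum.abs_summable_on_def)
  ultimately show ?thesis by (simp add: infsum_not_exists not_integrable_integral_eq)
qed

section \<open>Measurability of the functional\<close>

text \<open>As an integral against counting measure, which is sigma-finite on a countable type, the
  sum is measurable as soon as the terms are jointly measurable in outcome and index.\<close>

lemma borel_measurable_infsum:
  fixes f :: "'i::countable \<Rightarrow> 'a \<Rightarrow> real"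
  assumes f: "\<And>p. p \<in> A \<Longrightarrow> f p \<in> borel_measurable P"
  shows "(\<lambda>\<omega>. infsum (\<lambda>p. f p \<omega>) A) \<in> borel_measurable P"
proof -
  interpret sigma_finite_measure "count_space A"
    by (rule sigma_finite_measure_count_space_countable) auto
  have "(\<lambda>\<omega>p. f (snd \<omega>p) (fst \<omega>p)) \<in> borel_measurable (P \<Otimes>\<^sub>M count_space A)"
  proof (rule measurable_compose_countable'[where f="\<lambda>p \<omega>p. f p (fst \<omega>p)" and g=snd and I=A])
    show "(\<lambda>\<omega>p. f p (fst \<omega>p)) \<in> borel_measurable (P \<Otimes>\<^sub>M count_space A)" if "p \<in> A" for p
      by (rule measurable_compose[OF measurable_fst f[OF that]])
  qed auto
  then have "(\<lambda>(\<omega>, p). f p \<omega>) \<in> borel_measurable (P \<Otimes>\<^sub>M count_space A)"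
    by (simp add: case_prod_unfold)
  then show ?thesis unfolding infsum_eq_integral_count_space
    by (rule borel_measurable_lebesgue_integral)
qed

lemma measurable_Max_image_nat:
  fixes f :: "'k \<Rightarrow> 'a \<Rightarrow> nat"
  assumes "finite K" "K \<noteq> {}" "\<And>k. k \<in> K \<Longrightarrow> f k \<in> measurable P (count_space UNIV)"
  shows "(\<lambda>\<omega>. Max ((\<lambda>k. f k \<omega>) ` K)) \<in> measurable P (count_space UNIV)"
  using assms
proof (induction K rule: finite_ne_induct)
  case (insert k K)
  then have [measurable]: "f k \<in> measurable P (count_space UNIV)"
    "(\<lambda>\<omega>. Max ((\<lambda>k. f k \<omega>) ` K)) \<in> measurable P (count_space UNIV)" by auto
  have "(\<lambda>\<omega>. max (f k \<omega>) (Max ((\<lambda>k. f k \<omega>) ` K))) \<in> measurable P (count_space UNIV)" by measurable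
  with insert show ?case by simp
qed auto

lemma borel_measurable_arith_functional:
  assumes x: "\<And>k. x k \<in> borel_measurable P" and v: "\<And>k p. v k p \<in> measurable P (count_space UNIV)"
  shows "(\<lambda>\<omega>. arith_functional (\<lambda>k. x k \<omega>) (\<lambda>k p. v k p \<omega>)) \<in> borel_measurable P"
proof (rule measurable_coordinatewise_then_product)
  fix i
  note [measurable] = x
  have [measurable]: "(\<lambda>\<omega>. real (v k p \<omega>)) \<in> borel_measurable P" for k p
    by (rule measurable_compose[OF v]) auto
  have [measurable]: "(\<lambda>\<omega>. real (Max ((\<lambda>k. v k p \<omega>) ` {1..Suc i}))) \<in> borel_measurable P" for p
    by (rule measurable_compose[OF measurable_Max_image_nat]) (auto intro: v)
  have "(\<lambda>\<omega>. \<Sum>\<^sub>\<infinity>p\<in>{p. prime p}.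
     ln (real p) * (real (Max ((\<lambda>k. v k p \<omega>) ` {1..Suc i})) - real (\<Sum>k=1..Suc i. v k p \<omega>))) \<in> borel_measurable P"
    unfolding of_nat_sum by (rule borel_measurable_infsum) measurable
  then show "(\<lambda>\<omega>. arith_functional (\<lambda>k. x k \<omega>) (\<lambda>k p. v k p \<omega>) i) \<in> borel_measurable P"
    unfolding arith_functional_def by measurable
qed

section \<open>Truncation to finitely many events\<close>

type_synonym event_index = "(nat \<times> nat) + (nat \<times> nat \<times> nat)"

text \<open>Both kinds are one-sided thresholds, so an intersection of such events is again a
  threshold for each \<open>x k\<close> and each \<open>v k p\<close>; this makes joint
  probabilities computable.\<close>

fun basic_event :: "nat \<Rightarrow> (nat \<Rightarrow> real) \<Rightarrow> (nat \<Rightarrow> nat \<Rightarrow> nat) \<Rightarrow> event_index \<Rightarrow> bool" where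
  "basic_event N x v (Inl (k, a)) \<longleftrightarrow> x k \<le> real a / real (N^2)"
| "basic_event N x v (Inr (k, p, j)) \<longleftrightarrow> j \<le> v k p"

text \<open>The level \<open>a = N^2\<close> is left out because it says \<open>x k \<le> 1\<close>,
  which holds almost surely, and the exponent \<open>j = 0\<close> because it always holds.\<close>

definition event_indices :: "nat \<Rightarrow> nat \<Rightarrow> event_index set" where
  "event_indices M N = Inl ` ({1..M} \<times> {1..<N^2}) \<union> Inr ` ({1..M} \<times> {p. prime p \<and> p \<le> N} \<times> {1..N})"

text \<open>
  The argument \<open>S\<close> is the set of events that hold.  One plus the number of failing levels is
  \<open>\<lceil>N^2 x_k\<rceil>\<close>, and the number of holding exponents is \<open>min N (v_k(p))\<close>.
\<close>
definition truncated_functional :: "nat \<Rightarrow> event_index set \<Rightarrow> nat \<Rightarrow> real" where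
  "truncated_functional N S i =
     (\<Sum>k=1..Suc i. ln (real (Suc (card {a\<in>{1..<N^2}. Inl (k, a) \<notin> S})) / real (N^2))) +
     (\<Sum>p | prime p \<and> p \<le> N. ln (real p) *
        (real (Max ((\<lambda>k. card {j\<in>{1..N}. Inr (k, p, j) \<in> S}) ` {1..Suc i}))
         - real (\<Sum>k=1..Suc i. card {j\<in>{1..N}. Inr (k, p, j) \<in> S})))"

lemma finite_event_indices [simp]: "finite (event_indices M N)"
  unfolding event_indices_def by auto

text \<open>The failing grid points are those below the ceiling \<open>m\<close> of
  \<open>t * real K\<close>, so \<open>c = m\<close>. Rounding upwards keeps the value positive, as
  its logarithm requires.\<close>

lemma discretized_level:
  assumes t: "0 < t" "t \<le> (1::real)" and K: "K > 0"
  defines "c \<equiv> Suc (card {a\<in>{1..<K}. \<not> t \<le> real a / real K})"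
  shows "t \<le> real c / real K" "real c / real K < t + 1 / real K"
proof -
  define m where "m = nat \<lceil>t * real K\<rceil>"
  have pos: "0 < t * real K" using t K by simp
  then have ceil: "0 < \<lceil>t * real K\<rceil>" by simp
  have "t * real K \<le> real K" using t K by (simp add: mult_left_le_one_le)
  then have m: "0 < m" "m \<le> K" using ceil by (auto simp: m_def ceiling_le_iff nat_le_iff)
  have m': "t * real K \<le> real m" "real m < t * real K + 1"
    using ceil ceiling_correct[of "t * real K"] by (auto simp: m_def)
  have "(\<not> t \<le> real a / real K) \<longleftrightarrow> a < m" for a
  proof -
    have "(\<not> t \<le> real a / real K) \<longleftrightarrow> real a < t * real K" using K by (simp add: field_simps not_le)
    also have "\<dots> \<longleftrightarrow> a < m"
    proof
      assume "real a < t * real K" with m' show "a < m" by linarith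
    next
      assume "a < m" then have "real a + 1 \<le> real m" by linarith
      with m' show "real a < t * real K" by linarith
    qed
    finally show ?thesis .
  qed
  then have "{a\<in>{1..<K}. \<not> t \<le> real a / real K} = {a\<in>{1..<K}. a < m}" by (simp only:)
  also have "\<dots> = {1..<m}" using m by auto
  finally have "{a\<in>{1..<K}. \<not> t \<le> real a / real K} = {1..<m}" .
  then have "c = m" using m by (simp add: c_def)
  then show "t \<le> real c / real K" "real c / real K < t + 1 / real K"
    using m' K by (simp_all add: field_simps)
qed

text \<open>At most one value is nonzero, and it is then both the maximum and the sum. Thus a prime
  dividing at most one of the numbers contributes nothing to the functional.\<close>

lemma Max_image_eq_sum:
  fixes f :: "'k \<Rightarrow> nat"
  assumes K: "finite K" "K \<noteq> {}" and f: "\<And>k l. k \<in> K \<Longrightarrow> l \<in> K \<Longrightarrow> k \<noteq> l \<Longrightarrow> f k = 0 \<or> f l = 0"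
  shows "Max (f ` K) = sum f K"
proof (cases "\<exists>k\<in>K. f k \<noteq> 0")
  case True
  then obtain k where k: "k \<in> K" "f k \<noteq> 0" by auto
  then have z: "f l = 0" if "l \<in> K - {k}" for l using f[of k l] that by auto
  have "sum f K = f k" using K k z by (simp add: sum.remove)
  moreover have "Max (f ` K) = f k"
  proof (rule Max_eqI)
    fix y assume "y \<in> f ` K" then show "y \<le> f k" using z by fastforce
  qed (use K k in auto)
  ultimately show ?thesis by simp
next
  case False
  then have "f ` K = {0}" using K by auto
  then show ?thesis using False by simp
qed

lemma ln_diff_le_div:
  assumes "0 < (x::real)" "x \<le> y"
  shows "\<bar>ln y - ln x\<bar> \<le> (y - x) / x"
proof -
  have "ln x \<le> ln y" using assms by (simp add: ln_mono)
  moreover have "ln y - ln x = ln (y / x)" using assms by (simp add: ln_div)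
  moreover have "\<dots> \<le> y / x - 1" using assms by (intro ln_le_minus_one) auto
  ultimately show ?thesis using assms by (simp add: diff_divide_distrib)
qed

text \<open>Primes above \<open>N\<close> cancel by \<open>Max_image_eq_sum\<close>, and exponents
  at primes up to \<open>N\<close> are recovered exactly. Only the rounding of the ratios is left,
  costing at most \<open>1 / N\<close> for each index.\<close>

lemma truncation_error:
  assumes N: "N > 0" and i: "i < M"
    and x: "\<And>k. k \<in> {1..M} \<Longrightarrow> 1 / real N < x k" "\<And>k. k \<in> {1..M} \<Longrightarrow> x k \<le> 1"
    and small: "\<And>k p. k \<in> {1..M} \<Longrightarrow> prime p \<Longrightarrow> p \<le> N \<Longrightarrow> v k p \<le> N"
    and large: "\<And>k l p. k \<in> {1..M} \<Longrightarrow> l \<in> {1..M} \<Longrightarrow> k \<noteq> l \<Longrightarrow> prime p \<Longrightarrow> N < p \<Longrightarrow> v k p = 0 \<or> v l p = 0"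
  shows "\<bar>arith_functional x v i - truncated_functional N {s\<in>event_indices M N. basic_event N x v s} i\<bar> \<le> real M / real N"
proof -
  let ?S = "{s\<in>event_indices M N. basic_event N x v s}" and ?K = "{1..Suc i}"
  let ?c = "\<lambda>k. real (Suc (card {a\<in>{1..<N^2}. Inl (k, a) \<notin> ?S})) / real (N^2)"
  have K: "k \<in> {1..M}" if "k \<in> ?K" for k using i that by auto
  have level: "\<bar>ln (x k) - ln (?c k)\<bar> \<le> 1 / real N" if "k \<in> ?K" for k
  proof -
    have eq: "{a\<in>{1..<N^2}. Inl (k, a) \<notin> ?S} = {a\<in>{1..<N^2}. \<not> x k \<le> real a / real (N^2)}"
      using K[OF that] by (auto simp: event_indices_def)
    have pos: "0 < x k" using x(1)[OF K[OF that]] N by (smt (verit) divide_nonneg_nonneg of_nat_0_le_iff)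
    note lev = discretized_level[OF pos x(2)[OF K[OF that]], of "N^2", folded eq]
    have "\<bar>ln (x k) - ln (?c k)\<bar> \<le> (?c k - x k) / x k"
      using ln_diff_le_div[OF pos lev(1)] N by (simp add: abs_minus_commute)
    \<comment> \<open>The mesh is \<open>1 / N^2\<close> because ratios may be as small as
      \<open>1 / N\<close>: the relative rounding error is then still at most
      \<open>1 / N\<close>.\<close>
    also have "\<dots> \<le> (1 / real (N^2)) / (1 / real N)"
      using lev N pos x(1)[OF K[OF that]] by (intro frac_le) auto
    also have "\<dots> = 1 / real N" using N by (simp add: field_simps power2_eq_square)
    finally show ?thesis .
  qed
  have val: "card {j\<in>{1..N}. Inr (k, p, j) \<in> ?S} = v k p" if "k \<in> ?K" "prime p" "p \<le> N" for k p
  proof -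
    have "{j\<in>{1..N}. Inr (k, p, j) \<in> ?S} = {1..v k p}"
      using K[OF that(1)] that small[of k p] by (auto simp: event_indices_def)
    then show ?thesis by simp
  qed
  have inf: "(\<Sum>\<^sub>\<infinity>p\<in>{p. prime p}. ln (real p) * (real (Max ((\<lambda>k. v k p) ` ?K)) - real (\<Sum>k\<in>?K. v k p)))
    = (\<Sum>p | prime p \<and> p \<le> N. ln (real p) * (real (Max ((\<lambda>k. v k p) ` ?K)) - real (\<Sum>k\<in>?K. v k p)))"
  proof (rule infsum_finite_support)
    fix p assume "p \<in> {p. prime p} - {p. prime p \<and> p \<le> N}"
    then have "Max ((\<lambda>k. v k p) ` ?K) = (\<Sum>k\<in>?K. v k p)"
      using i by (intro Max_image_eq_sum large) auto
    then show "ln (real p) * (real (Max ((\<lambda>k. v k p) ` ?K)) - real (\<Sum>k\<in>?K. v k p)) = 0" by simp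
  qed auto
  also have "\<dots> = (\<Sum>p | prime p \<and> p \<le> N. ln (real p) *
        (real (Max ((\<lambda>k. card {j\<in>{1..N}. Inr (k, p, j) \<in> ?S}) ` ?K))
         - real (\<Sum>k\<in>?K. card {j\<in>{1..N}. Inr (k, p, j) \<in> ?S})))"
  proof (rule sum.cong[OF refl])
    fix p assume "p \<in> {p. prime p \<and> p \<le> N}"
    then have *: "card {j\<in>{1..N}. Inr (k, p, j) \<in> ?S} = v k p" if "k \<in> ?K" for k using val that by auto
    have "(\<lambda>k. card {j\<in>{1..N}. Inr (k, p, j) \<in> ?S}) ` ?K = (\<lambda>k. v k p) ` ?K"
      "(\<Sum>k\<in>?K. card {j\<in>{1..N}. Inr (k, p, j) \<in> ?S}) = (\<Sum>k\<in>?K. v k p)"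
      by (intro image_cong sum.cong refl *; assumption)+
    then show "ln (real p) * (real (Max ((\<lambda>k. v k p) ` ?K)) - real (\<Sum>k\<in>?K. v k p)) =
       ln (real p) * (real (Max ((\<lambda>k. card {j\<in>{1..N}. Inr (k, p, j) \<in> ?S}) ` ?K))
         - real (\<Sum>k\<in>?K. card {j\<in>{1..N}. Inr (k, p, j) \<in> ?S}))" by (simp only:)
  qed
  finally have "arith_functional x v i - truncated_functional N ?S i = (\<Sum>k\<in>?K. ln (x k) - ln (?c k))"
    unfolding arith_functional_def truncated_functional_def sum_subtractf by linarith
  also have "\<bar>\<dots>\<bar> \<le> (\<Sum>k\<in>?K. 1 / real N)"
    by (rule order.trans[OF sum_abs sum_mono]) (rule level)
  also have "\<dots> \<le> real M / real N" using i N by (simp add: divide_right_mono)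
  finally show ?thesis .
qed

section \<open>Truncation bounds uniform over models\<close>

text \<open>What the draws from \<open>[n]\<close> and the limit variables share. The bounds do not
  mention \<open>n\<close>, so every error estimate derived here is uniform in
  \<open>n\<close>.\<close>

locale valuation_model = prob_space P for P :: "'a measure" +
  fixes x :: "nat \<Rightarrow> 'a \<Rightarrow> real" and v :: "nat \<Rightarrow> nat \<Rightarrow> 'a \<Rightarrow> nat"
  assumes x_measurable [measurable]: "\<And>k. x k \<in> borel_measurable P"
    and v_measurable [measurable]: "\<And>k p. v k p \<in> measurable P (count_space UNIV)"
    and x_le_1: "\<And>k. AE \<omega> in P. x k \<omega> \<le> 1"
    and x_small: "\<And>k e. 0 < e \<Longrightarrow> e \<le> 1 \<Longrightarrow> prob {\<omega>\<in>space P. x k \<omega> \<le> e} \<le> e"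
    and v_tail: "\<And>k p j. prime p \<Longrightarrow> prob {\<omega>\<in>space P. j \<le> v k p \<omega>} \<le> 1 / real p ^ j"
    and v_pair: "\<And>k l p. k \<noteq> l \<Longrightarrow> prime p \<Longrightarrow> prob {\<omega>\<in>space P. 1 \<le> v k p \<omega> \<and> 1 \<le> v l p \<omega>} \<le> 1 / real p ^ 2"
begin

text \<open>The three ways in which the hypotheses of \<open>truncation_error\<close> can fail: a
  small ratio, a high power of a small prime, a large prime shared by two indices. Integers above
  \<open>N\<close> are written \<open>q + Suc N\<close> to obtain a union indexed by all
  naturals.\<close>

definition bad :: "nat \<Rightarrow> nat \<Rightarrow> 'a set" where
  "bad M N = (\<Union>k\<in>{1..M}. {\<omega>\<in>space P. x k \<omega> \<le> 1 / real N}) \<union>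
     (\<Union>(k, p)\<in>{1..M} \<times> {p. prime p \<and> p \<le> N}. {\<omega>\<in>space P. Suc N \<le> v k p \<omega>}) \<union>
     (\<Union>q. \<Union>(k, l)\<in>{1..M} \<times> {1..M}. {\<omega>\<in>space P. k \<noteq> l \<and> prime (q + Suc N) \<and> 1 \<le> v k (q + Suc N) \<omega> \<and> 1 \<le> v l (q + Suc N) \<omega>})"

lemma bad_sets [measurable]: "bad M N \<in> sets P"
  unfolding bad_def by (intro sets.Un sets.finite_UN sets.countable_nat_UN) (auto, measurable)

text \<open>Union bounds, one for each part of \<open>bad\<close>: \<open>M\<close> indices;
  \<open>M\<close> indices times at most \<open>N\<close> primes, each at least 2; and at most
  \<open>M^2\<close> pairs for each integer above \<open>N\<close>, which leaves a tail of the
  series of inverse squares.\<close>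

lemma prob_bad_le:
  assumes N: "N > 0"
  shows "prob (bad M N) \<le> real M / real N + real M * real N * (1 / 2 ^ Suc N) + real M ^ 2 * (\<Sum>q. 1 / real (q + Suc N) ^ 2)"
proof -
  let ?A = "\<lambda>k. {\<omega>\<in>space P. x k \<omega> \<le> 1 / real N}"
  let ?B = "\<lambda>(k, p). {\<omega>\<in>space P. Suc N \<le> v k p \<omega>}"
  let ?C = "\<lambda>q (k, l). {\<omega>\<in>space P. k \<noteq> l \<and> prime (q + Suc N) \<and> 1 \<le> v k (q + Suc N) \<omega> \<and> 1 \<le> v l (q + Suc N) \<omega>}"
  let ?PN = "{p. prime p \<and> p \<le> N}"
  let ?CU = "\<lambda>q. \<Union>kl\<in>{1..M} \<times> {1..M}. ?C q kl"
  have fin: "finite ?PN" by auto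
  have mA: "?A k \<in> events" for k by measurable
  have mB: "?B kp \<in> events" for kp by (cases kp) simp
  have mC: "?C q kl \<in> events" for q kl by (cases kl) simp
  have mCU: "?CU q \<in> events" for q using mC by (intro sets.finite_UN) auto
  have A: "prob (\<Union>k\<in>{1..M}. ?A k) \<le> real M / real N"
  proof -
    have "prob (\<Union>k\<in>{1..M}. ?A k) \<le> (\<Sum>k\<in>{1..M}. prob (?A k))"
      using mA by (intro finite_measure_subadditive_finite) auto
    also have "\<dots> \<le> (\<Sum>k\<in>{1..M}. 1 / real N)" using N by (intro sum_mono x_small) auto
    finally show ?thesis by simp
  qed
  have B: "prob (\<Union>kp\<in>{1..M} \<times> ?PN. ?B kp) \<le> real M * real N * (1 / 2 ^ Suc N)"
  proof -
    have "prob (\<Union>kp\<in>{1..M} \<times> ?PN. ?B kp) \<le> (\<Sum>kp\<in>{1..M} \<times> ?PN. prob (?B kp))"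
      using mB fin by (intro finite_measure_subadditive_finite) auto
    also have "\<dots> \<le> (\<Sum>kp\<in>{1..M} \<times> ?PN. 1 / 2 ^ Suc N)"
    proof (rule sum_mono)
      fix kp assume "kp \<in> {1..M} \<times> ?PN"
      then obtain k p where kp: "kp = (k, p)" and p: "prime p" by auto
      have "prob (?B kp) \<le> 1 / real p ^ Suc N" using v_tail[OF p, of "Suc N" k] by (simp add: kp)
      also have "\<dots> \<le> 1 / 2 ^ Suc N"
        using prime_ge_2_nat[OF p] by (intro divide_left_mono power_mono) (auto simp: prime_gt_0_nat[OF p])
      finally show "prob (?B kp) \<le> 1 / 2 ^ Suc N" .
    qed
    also have "\<dots> = real M * real (card ?PN) * (1 / 2 ^ Suc N)"
      by (simp add: card_cartesian_product)
    also have "\<dots> \<le> real M * real N * (1 / 2 ^ Suc N)"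
    proof -
      have "card ?PN \<le> card {1..N}" by (intro card_mono) (auto simp: Suc_leI prime_gt_0_nat)
      then show ?thesis by (intro mult_right_mono mult_left_mono) auto
    qed
    finally show ?thesis .
  qed
  have sm: "summable (\<lambda>q. 1 / real (q + Suc N) ^ 2)"
    using summable_ignore_initial_segment[OF inverse_power_summable[of 2, where 'a=real], of "Suc N"]
    by (simp add: inverse_eq_divide)
  have CU: "prob (?CU q) \<le> real M ^ 2 * (1 / real (q + Suc N) ^ 2)" for q
  proof -
    have "prob (?CU q) \<le> (\<Sum>kl\<in>{1..M} \<times> {1..M}. prob (?C q kl))"
      using mC by (intro finite_measure_subadditive_finite) auto
    also have "\<dots> \<le> (\<Sum>kl\<in>{1..M} \<times> {1..M}. 1 / real (q + Suc N) ^ 2)"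
    proof (rule sum_mono)
      fix kl
      show "prob (?C q kl) \<le> 1 / real (q + Suc N) ^ 2"
        using v_pair[of "fst kl" "snd kl" "q + Suc N"]
        by (cases "fst kl \<noteq> snd kl \<and> prime (q + Suc N)") (auto simp: case_prod_unfold)
    qed
    also have "\<dots> = real M ^ 2 * (1 / real (q + Suc N) ^ 2)"
      by (simp add: card_cartesian_product power2_eq_square)
    finally show ?thesis .
  qed
  have sm2: "summable (\<lambda>q. prob (?CU q))"
    by (rule summable_comparison_test'[OF summable_mult[OF sm, of "real M ^ 2"], of 0])
      (use CU in \<open>simp add: measure_nonneg\<close>)
  have C: "prob (\<Union>q. ?CU q) \<le> real M ^ 2 * (\<Sum>q. 1 / real (q + Suc N) ^ 2)"
  proof -
    have "prob (\<Union>q. ?CU q) \<le> (\<Sum>q. prob (?CU q))"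
      using mCU sm2 by (intro finite_measure_subadditive_countably) auto
    also have "\<dots> \<le> (\<Sum>q. real M ^ 2 * (1 / real (q + Suc N) ^ 2))"
      by (intro suminf_le sm2 summable_mult sm CU)
    also have "\<dots> = real M ^ 2 * (\<Sum>q. 1 / real (q + Suc N) ^ 2)"
      by (rule suminf_mult[OF sm])
    finally show ?thesis .
  qed
  have m1: "(\<Union>k\<in>{1..M}. ?A k) \<in> events" using mA by (intro sets.finite_UN) auto
  have m2: "(\<Union>kp\<in>{1..M} \<times> ?PN. ?B kp) \<in> events" using mB fin by (intro sets.finite_UN) auto
  have m3: "(\<Union>q. ?CU q) \<in> events" using mCU by (intro sets.countable_nat_UN) auto
  have "prob (bad M N) \<le> prob (\<Union>k\<in>{1..M}. ?A k) + prob (\<Union>kp\<in>{1..M} \<times> ?PN. ?B kp) + prob (\<Union>q. ?CU q)"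
    unfolding bad_def using measure_Un_le[OF sets.Un[OF m1 m2] m3] measure_Un_le[OF m1 m2]
    by linarith
  with A B C show ?thesis by linarith
qed

definition profile :: "nat \<Rightarrow> nat \<Rightarrow> 'a \<Rightarrow> event_index set" where
  "profile M N \<omega> = {s\<in>event_indices M N. basic_event N (\<lambda>k. x k \<omega>) (\<lambda>k p. v k p \<omega>) s}"

lemma basic_event_sets [measurable]:
  "{\<omega>\<in>space P. basic_event N (\<lambda>k. x k \<omega>) (\<lambda>k p. v k p \<omega>) s} \<in> events"
  by (cases "(N, \<lambda>k. x k undefined, \<lambda>k p. v k p undefined, s)" rule: basic_event.cases) (auto, measurable)

lemma integrable_profile:
  fixes g :: "event_index set \<Rightarrow> real"
  shows "integrable P (\<lambda>\<omega>. g (profile M N \<omega>))"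
proof -
  obtain c where "\<forall>S\<subseteq>event_indices M N. g S = (\<Sum>J\<in>Pow S. c J)"
    using subset_sum_representation[of "event_indices M N" g] by auto
  then show ?thesis unfolding profile_def
    by (intro expectation_finite_events(1)[where c=c] prob_space_axioms) auto
qed

text \<open>Outside \<open>bad\<close> each of the \<open>M\<close> relevant coordinates is off by
  at most \<open>M / N\<close>, which the Lipschitz bound turns into the first term; on
  \<open>bad\<close> the difference is at most \<open>2 * C\<close>.\<close>

lemma expectation_truncation_error:
  assumes N: "N > 0" and h: "h \<in> borel_measurable borel" "\<And>y. \<bar>h y\<bar> \<le> C" and L: "0 \<le> L"
    and lip: "\<And>y z. \<bar>h y - h z\<bar> \<le> L * (\<Sum>i<M. \<bar>y i - z i\<bar>)"
  shows "\<bar>expectation (\<lambda>\<omega>. h (arith_functional (\<lambda>k. x k \<omega>) (\<lambda>k p. v k p \<omega>)))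
      - expectation (\<lambda>\<omega>. h (truncated_functional N (profile M N \<omega>)))\<bar> \<le>
    L * (real M * (real M / real N)) + 2 * C * (real M / real N + real M * real N * (1 / 2 ^ Suc N) + real M ^ 2 * (\<Sum>q. 1 / real (q + Suc N) ^ 2))"
proof -
  let ?f = "\<lambda>\<omega>. h (arith_functional (\<lambda>k. x k \<omega>) (\<lambda>k p. v k p \<omega>))"
  let ?g = "\<lambda>\<omega>. h (truncated_functional N (profile M N \<omega>))"
  have C: "0 \<le> C" using h(2)[of undefined] by linarith
  have f: "integrable P ?f"
    by (rule integrable_const_bound[of _ C])
      (use h in \<open>auto intro!: measurable_compose[OF borel_measurable_arith_functional[OF x_measurable v_measurable]]\<close>)
  have g: "integrable P ?g" by (rule integrable_profile)
  have "\<bar>expectation ?f - expectation ?g\<bar> = \<bar>expectation (\<lambda>\<omega>. ?f \<omega> - ?g \<omega>)\<bar>"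
    using f g by simp
  also have "\<dots> \<le> expectation (\<lambda>\<omega>. \<bar>?f \<omega> - ?g \<omega>\<bar>)" by (rule integral_abs_bound)
  also have "\<dots> \<le> expectation (\<lambda>\<omega>. L * (real M * (real M / real N)) + 2 * C * indicat_real (bad M N) \<omega>)"
  proof (rule integral_mono_AE)
    have "AE \<omega> in P. \<forall>k\<in>{1..M}. x k \<omega> \<le> 1"
      using x_le_1 by (intro AE_finite_allI) auto
    then show "AE \<omega> in P. \<bar>?f \<omega> - ?g \<omega>\<bar> \<le> L * (real M * (real M / real N)) + 2 * C * indicat_real (bad M N) \<omega>"
      using AE_space
    proof eventually_elim
      case (elim \<omega>)
      have nn: "0 \<le> L * (real M * (real M / real N))" using L by simp
      show ?case
      proof (cases "\<omega> \<in> bad M N")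
        case True
        have "\<bar>?f \<omega> - ?g \<omega>\<bar> \<le> 2 * C"
          using h(2)[of "arith_functional (\<lambda>k. x k \<omega>) (\<lambda>k p. v k p \<omega>)"]
            h(2)[of "truncated_functional N (profile M N \<omega>)"] by linarith
        then show ?thesis using True nn by (simp only: indicator_simps mult_1_right)
      next
        case False
        have "\<bar>arith_functional (\<lambda>k. x k \<omega>) (\<lambda>k p. v k p \<omega>) i - truncated_functional N (profile M N \<omega>) i\<bar> \<le> real M / real N"
          if "i < M" for i
          unfolding profile_def
        proof (rule truncation_error[OF N that])
          show "x k \<omega> \<le> 1" if "k \<in> {1..M}" for k using elim that by auto
          show "1 / real N < x k \<omega>" if "k \<in> {1..M}" for k
          proof (rule ccontr)
            assume "\<not> 1 / real N < x k \<omega>"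
            then have "\<omega> \<in> bad M N" unfolding bad_def using that elim by (intro UnI1 UN_I[of k]) auto
            with False show False by simp
          qed
          show "v k p \<omega> \<le> N" if "k \<in> {1..M}" "prime p" "p \<le> N" for k p
          proof (rule ccontr)
            assume "\<not> v k p \<omega> \<le> N"
            then have "\<omega> \<in> bad M N" unfolding bad_def using that elim by (intro UnI1 UnI2 UN_I[of "(k,p)"]) auto
            with False show False by simp
          qed
          show "v k p \<omega> = 0 \<or> v l p \<omega> = 0" if "k \<in> {1..M}" "l \<in> {1..M}" "k \<noteq> l" "prime p" "N < p" for k l p
          proof (rule ccontr)
            assume "\<not> (v k p \<omega> = 0 \<or> v l p \<omega> = 0)"
            moreover have "(p - Suc N) + Suc N = p" using that by simp
            ultimately have "\<omega> \<in> bad M N" unfolding bad_def using that elim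
              by (intro UnI2 UN_I[of "p - Suc N"] UN_I[of "(k,l)"]) auto
            with False show False by simp
          qed
        qed
        then have "(\<Sum>i<M. \<bar>arith_functional (\<lambda>k. x k \<omega>) (\<lambda>k p. v k p \<omega>) i - truncated_functional N (profile M N \<omega>) i\<bar>)
            \<le> (\<Sum>i<M. real M / real N)" by (intro sum_mono) auto
        then have "L * (\<Sum>i<M. \<bar>arith_functional (\<lambda>k. x k \<omega>) (\<lambda>k p. v k p \<omega>) i - truncated_functional N (profile M N \<omega>) i\<bar>)
            \<le> L * (real M * (real M / real N))" using L by (intro mult_left_mono) auto
        with lip[of "arith_functional (\<lambda>k. x k \<omega>) (\<lambda>k p. v k p \<omega>)" "truncated_functional N (profile M N \<omega>)"] False
        show ?thesis by simp
      qed
    qed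
  qed (use f g in \<open>auto simp: emeasure_eq_measure\<close>)
  also have "\<dots> = L * (real M * (real M / real N)) + 2 * C * prob (bad M N)"
    by (subst Bochner_Integration.integral_add) (auto simp: emeasure_eq_measure prob_space)
  also have "\<dots> \<le> L * (real M * (real M / real N)) + 2 * C * (real M / real N + real M * real N * (1 / 2 ^ Suc N) + real M ^ 2 * (\<Sum>q. 1 / real (q + Suc N) ^ 2))"
    using prob_bad_le[OF N, of M] C by (intro add_left_mono mult_left_mono) auto
  finally show ?thesis .
qed

end

section \<open>The uniform and the geometric model\<close>

lemma measure_PiM_cylinder:
  assumes M: "\<And>i. prob_space (M i)" and J: "finite J" "\<And>i. i \<in> J \<Longrightarrow> A i \<in> sets (M i)"
  shows "measure (PiM UNIV M) {\<omega>\<in>space (PiM UNIV M). \<forall>i\<in>J. \<omega> i \<in> A i} = (\<Prod>i\<in>J. measure (M i) (A i))"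
proof -
  interpret product_prob_space M UNIV
    by (intro product_prob_spaceI M)
  show ?thesis
    using emeasure_PiM_Collect[of J A] J
    by (simp add: emeasure_eq_measure M.emeasure_eq_measure prod_ennreal prod_nonneg)
qed

section \<open>Independent uniform draws from [n]\<close>

lemma space_U_space [simp]: "space (U_space n) = UNIV"
  by (simp add: U_space_def space_PiM)

lemma prob_space_U_space: "prob_space (U_space n)"
  unfolding U_space_def by (intro prob_space_PiM measure_pmf.prob_space_axioms)

lemma measurable_U_space_coordinate: "(\<lambda>\<omega>. \<omega> k) \<in> measurable (U_space n) (count_space UNIV)"
proof -
  have "(\<lambda>\<omega>. \<omega> k) \<in> measurable (U_space n) (measure_pmf (pmf_of_set {1..n}))"
    unfolding U_space_def by (rule measurable_component_singleton) simp
  then show ?thesis using measurable_cong_sets[OF refl, of "measure_pmf (pmf_of_set {1..n})" "count_space UNIV" "U_space n"]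
    by simp
qed

lemma measurable_U_space_compose: "(\<lambda>\<omega>. f (\<omega> k)) \<in> measurable (U_space n) (count_space UNIV)"
  by (rule measurable_compose[OF measurable_U_space_coordinate]) simp

lemma measure_U_space_cylinder:
  assumes "n > 0" "finite J"
  shows "measure (U_space n) {\<omega>. \<forall>k\<in>J. \<omega> k \<in> A k} = (\<Prod>k\<in>J. real (card ({1..n} \<inter> A k)) / real n)"
proof -
  have "measure (U_space n) {\<omega>\<in>space (U_space n). \<forall>k\<in>J. \<omega> k \<in> A k} = (\<Prod>k\<in>J. measure (measure_pmf (pmf_of_set {1..n})) (A k))"
    unfolding U_space_def using assms by (intro measure_PiM_cylinder measure_pmf.prob_space_axioms) auto
  also have "\<dots> = (\<Prod>k\<in>J. real (card ({1..n} \<inter> A k)) / real n)"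
    using assms by (intro prod.cong refl, subst measure_pmf_of_set) auto
  finally show ?thesis by simp
qed

lemma AE_U_space:
  assumes "n > 0"
  shows "AE \<omega> in U_space n. \<omega> k \<in> {1..n}"
proof -
  interpret prob_space "U_space n" by (rule prob_space_U_space)
  have "prob {\<omega>. \<forall>i\<in>{k}. \<omega> i \<in> {1..n}} = 1"
    using assms by (subst measure_U_space_cylinder) auto
  then show ?thesis
    using prob_Collect_eq_1[of "\<lambda>\<omega>. \<omega> k \<in> {1..n}"] measurable_U_space_compose[of "\<lambda>u. u \<in> {1..n}" k n]
    by (simp add: pred_def)
qed

lemma card_dvd_upto:
  assumes "d > 0"
  shows "card {u\<in>{1..m}. d dvd u} = m div d"
proof -
  have "{u\<in>{1..m}. d dvd u} = (\<lambda>q. d * q) ` {1..m div d}"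
  proof (intro equalityI subsetI)
    fix u assume "u \<in> {u\<in>{1..m}. d dvd u}"
    then obtain q where "u = d * q" "1 \<le> d * q" "d * q \<le> m" by auto
    then have "q \<in> {1..m div d}" using assms by (auto simp: less_eq_div_iff_mult_less_eq mult.commute intro: Suc_leI Nat.gr0I)
    with \<open>u = d * q\<close> show "u \<in> (\<lambda>q. d * q) ` {1..m div d}" by auto
  qed (use assms in \<open>auto simp: less_eq_div_iff_mult_less_eq mult.commute\<close>)
  moreover have "inj_on (\<lambda>q. d * q) {1..m div d}" using assms by (auto simp: inj_on_def)
  ultimately show ?thesis by (simp add: card_image)
qed

lemma le_multiplicity_iff_dvd:
  assumes "prime (p::nat)" "u > 0"
  shows "j \<le> multiplicity p u \<longleftrightarrow> p ^ j dvd u"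
  using assms by (intro power_dvd_iff_le_multiplicity[symmetric]) (auto simp: prime_nat_iff)

lemma card_multiplicity_le:
  assumes "prime p"
  shows "real (card ({1..n} \<inter> {u. j \<le> multiplicity p u})) / real n \<le> 1 / real p ^ j"
proof -
  have "{1..n} \<inter> {u. j \<le> multiplicity p u} = {u\<in>{1..n}. p ^ j dvd u}"
    using le_multiplicity_iff_dvd[OF assms] by (auto simp: Suc_le_eq)
  then have "real (card ({1..n} \<inter> {u. j \<le> multiplicity p u})) = real (n div p ^ j)"
    using prime_gt_0_nat[OF assms] by (simp only: card_dvd_upto zero_less_power)
  also have "\<dots> \<le> real n / real p ^ j" using of_nat_div_le_of_nat[of n "p ^ j", where 'a=real] by simp
  finally have "real (card ({1..n} \<inter> {u. j \<le> multiplicity p u})) / real n \<le> real n / real p ^ j / real n"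
    by (rule divide_right_mono) simp
  also have "\<dots> \<le> 1 / real p ^ j" by (cases "n = 0") auto
  finally show ?thesis .
qed

text \<open>Each bound is a cylinder probability that counts integers or multiples of
  \<open>p ^ j\<close> up to \<open>n\<close>. For \<open>v_pair\<close>, independence of the two
  draws multiplies two bounds \<open>1 / p\<close>.\<close>

lemma valuation_model_U_space:
  assumes n: "n > 0"
  shows "valuation_model (U_space n) (\<lambda>k \<omega>. real (\<omega> k) / real n) (\<lambda>k p \<omega>. multiplicity p (\<omega> k))"
proof -
  interpret prob_space "U_space n" by (rule prob_space_U_space)
  show ?thesis
  proof
    fix k p :: nat
    show "(\<lambda>\<omega>. real (\<omega> k) / real n) \<in> borel_measurable (U_space n)"
      by (rule measurable_compose[OF measurable_U_space_coordinate]) simp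
    show "(\<lambda>\<omega>. multiplicity p (\<omega> k)) \<in> measurable (U_space n) (count_space UNIV)"
      by (rule measurable_U_space_compose)
    show "AE \<omega> in U_space n. real (\<omega> k) / real n \<le> 1"
      using AE_U_space[OF n, of k] by eventually_elim (use n in auto)
  next
    fix k :: nat and e :: real assume e: "0 < e"
    have "prob {\<omega>. \<forall>i\<in>{k}. \<omega> i \<in> {u. real u / real n \<le> e}} = real (card ({1..n} \<inter> {u. real u / real n \<le> e})) / real n"
      using n by (subst measure_U_space_cylinder) auto
    also have "\<dots> \<le> real (card {1..nat \<lfloor>e * real n\<rfloor>}) / real n"
      using n e by (intro divide_right_mono of_nat_mono card_mono) (auto simp: field_simps le_nat_iff le_floor_iff)
    also have "\<dots> \<le> e * real n / real n" using e by (intro divide_right_mono) auto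
    finally show "prob {\<omega>\<in>space (U_space n). real (\<omega> k) / real n \<le> e} \<le> e" using n by simp
  next
    fix k p j :: nat assume p: "prime p"
    have "prob {\<omega>. \<forall>i\<in>{k}. \<omega> i \<in> {u. j \<le> multiplicity p u}} \<le> 1 / real p ^ j"
      using n card_multiplicity_le[OF p, of n j] by (subst measure_U_space_cylinder) auto
    then show "prob {\<omega>\<in>space (U_space n). j \<le> multiplicity p (\<omega> k)} \<le> 1 / real p ^ j" by simp
  next
    fix k l p :: nat assume kl: "k \<noteq> l" and p: "prime p"
    let ?c = "real (card ({1..n} \<inter> {u. 1 \<le> multiplicity p u})) / real n"
    have "prob {\<omega>. \<forall>i\<in>{k, l}. \<omega> i \<in> {u. 1 \<le> multiplicity p u}} = ?c * ?c"
      using n kl by (subst measure_U_space_cylinder) auto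
    also have "\<dots> \<le> (1 / real p) * (1 / real p)"
      using card_multiplicity_le[OF p, of n 1] by (intro mult_mono) auto
    finally show "prob {\<omega>\<in>space (U_space n). 1 \<le> multiplicity p (\<omega> k) \<and> 1 \<le> multiplicity p (\<omega> l)} \<le> 1 / real p ^ 2"
      by (simp add: power2_eq_square)
  qed
qed

section \<open>The limit space\<close>

lemma prob_space_G_space: "prob_space G_space"
  unfolding G_space_def by (intro prob_space_PiM measure_pmf.prob_space_axioms)

lemma prob_space_uniform_01: "prob_space (uniform_measure lborel {0..1::real})"
  by (rule prob_space_uniform_measure) auto

lemma prob_space_Unif_space: "prob_space Unif_space"
  unfolding Unif_space_def by (intro prob_space_PiM prob_space_uniform_01)

lemma prob_space_lim_space: "prob_space lim_space"
proof -
  interpret G: prob_space G_space by (rule prob_space_G_space)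
  interpret U: prob_space Unif_space by (rule prob_space_Unif_space)
  interpret pair_prob_space G_space Unif_space ..
  show ?thesis unfolding lim_space_def by (rule prob_space_axioms)
qed

lemma space_lim_space [simp]: "space lim_space = UNIV"
  by (simp add: lim_space_def G_space_def Unif_space_def space_pair_measure space_PiM)

lemma measure_lim_space_cylinder:
  fixes A :: "nat \<times> nat \<Rightarrow> nat set" and B :: "nat \<Rightarrow> real set"
  assumes "finite J" "finite K" "\<And>k. k \<in> K \<Longrightarrow> B k \<in> sets borel"
  shows "measure lim_space {\<omega>. (\<forall>i\<in>J. fst \<omega> i \<in> A i) \<and> (\<forall>k\<in>K. snd \<omega> k \<in> B k)} =
    (\<Prod>i\<in>J. measure (measure_pmf (if prime (snd i) then geometric_pmf (1 - 1 / real (snd i)) else return_pmf 0)) (A i)) *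
    (\<Prod>k\<in>K. measure lborel ({0..1} \<inter> B k))"
proof -
  interpret G: prob_space G_space by (rule prob_space_G_space)
  interpret U: prob_space Unif_space by (rule prob_space_Unif_space)
  let ?A = "{\<omega>\<in>space G_space. \<forall>i\<in>J. \<omega> i \<in> A i}" and ?B = "{\<omega>\<in>space Unif_space. \<forall>k\<in>K. \<omega> k \<in> B k}"
  have sp: "space G_space = UNIV" "space Unif_space = UNIV"
    by (simp_all add: G_space_def Unif_space_def space_PiM)
  have A: "?A \<in> sets G_space" unfolding G_space_def
    using assms by (intro sets.sets_Collect_finite_All sets_Collect_single') auto
  have B: "?B \<in> sets Unif_space" unfolding Unif_space_def
    using assms by (intro sets.sets_Collect_finite_All sets_Collect_single') auto
  have "{\<omega>. (\<forall>i\<in>J. fst \<omega> i \<in> A i) \<and> (\<forall>k\<in>K. snd \<omega> k \<in> B k)} = ?A \<times> ?B"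
    by (auto simp: sp)
  then have "measure lim_space {\<omega>. (\<forall>i\<in>J. fst \<omega> i \<in> A i) \<and> (\<forall>k\<in>K. snd \<omega> k \<in> B k)}
     = measure G_space ?A * measure Unif_space ?B"
    unfolding lim_space_def using U.emeasure_pair_measure_Times[OF A B]
    by (simp add: measure_def enn2real_mult)
  also have "measure G_space ?A = (\<Prod>i\<in>J. measure (measure_pmf (if prime (snd i) then geometric_pmf (1 - 1 / real (snd i)) else return_pmf 0)) (A i))"
    unfolding G_space_def using assms by (intro measure_PiM_cylinder measure_pmf.prob_space_axioms) auto
  also have "measure Unif_space ?B = (\<Prod>k\<in>K. measure (uniform_measure lborel {0..1::real}) (B k))"
    unfolding Unif_space_def using assms by (intro measure_PiM_cylinder prob_space_uniform_01) auto
  also have "\<dots> = (\<Prod>k\<in>K. measure lborel ({0..1} \<inter> B k))"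
    using assms by (intro prod.cong refl, subst measure_uniform_measure) auto
  finally show ?thesis .
qed

text \<open>\<open>geometric_pmf\<close> counts failures before the first success, so success
  probability \<open>1 - 1 / p\<close> gives the tail required of the variables \<open>G\<close>.
  The complement is a finite geometric sum.\<close>

lemma measure_geometric_atLeast:
  assumes "prime p"
  shows "measure (measure_pmf (geometric_pmf (1 - 1 / real p))) {j..} = 1 / real p ^ j"
proof -
  let ?q = "1 / real p" and ?G = "geometric_pmf (1 - 1 / real p)"
  have p: "real p \<ge> 2" using prime_ge_2_nat[OF assms] by simp
  then have q: "0 < 1 - ?q" "1 - ?q \<le> 1" by (auto simp: field_simps)
  have "measure (measure_pmf ?G) {..<j} = (\<Sum>i<j. ?q ^ i * (1 - ?q))"
    using q by (subst measure_measure_pmf_finite) (auto simp: pmf_geometric)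
  also have "\<dots> = 1 - ?q ^ j"
    unfolding one_diff_power_eq[of ?q j] by (simp add: sum_distrib_left mult.commute)
  finally have "measure (measure_pmf ?G) {..<j} = 1 - ?q ^ j" .
  moreover have "measure (measure_pmf ?G) {j..} = 1 - measure (measure_pmf ?G) {..<j}"
    using measure_pmf.prob_compl[of "{..<j}" ?G] by (simp add: Compl_eq_Diff_UNIV[symmetric] not_less)
  ultimately show ?thesis by (simp add: power_divide)
qed

lemma measurable_lim_space_G: "(\<lambda>\<omega>. fst \<omega> i) \<in> measurable lim_space (count_space UNIV)"
proof -
  let ?D = "\<lambda>kp::nat \<times> nat. measure_pmf (if prime (snd kp) then geometric_pmf (1 - 1 / real (snd kp)) else return_pmf 0)"
  have "(\<lambda>\<omega>. \<omega> i) \<in> measurable G_space (?D i)"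
    unfolding G_space_def by (rule measurable_component_singleton) simp
  then have "(\<lambda>\<omega>. \<omega> i) \<in> measurable G_space (count_space UNIV)"
    using measurable_cong_sets[OF refl, of "?D i" "count_space UNIV" G_space] by simp
  then show ?thesis unfolding lim_space_def by (rule measurable_compose[OF measurable_fst])
qed

lemma measurable_lim_space_U: "(\<lambda>\<omega>. snd \<omega> k) \<in> borel_measurable lim_space"
proof -
  have "(\<lambda>\<omega>. \<omega> k) \<in> measurable Unif_space (uniform_measure lborel {0..1::real})"
    unfolding Unif_space_def by (rule measurable_component_singleton) simp
  then have "(\<lambda>\<omega>. \<omega> k) \<in> borel_measurable Unif_space"
    using measurable_cong_sets[OF refl, of "uniform_measure lborel {0..1::real}" borel Unif_space] by simp
  then show ?thesis unfolding lim_space_def by (rule measurable_compose[OF measurable_snd])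
qed

lemma valuation_model_lim_space:
  "valuation_model lim_space (\<lambda>k \<omega>. snd \<omega> k) (\<lambda>k p \<omega>. fst \<omega> (k, p))"
proof -
  interpret prob_space lim_space by (rule prob_space_lim_space)
  show ?thesis
  proof
    fix k p :: nat
    show "(\<lambda>\<omega>. snd \<omega> k) \<in> borel_measurable lim_space" by (rule measurable_lim_space_U)
    show "(\<lambda>\<omega>. fst \<omega> (k, p)) \<in> measurable lim_space (count_space UNIV)" by (rule measurable_lim_space_G)
    have "prob {\<omega>\<in>space lim_space. snd \<omega> k \<le> 1} = 1"
      using measure_lim_space_cylinder[of "{}" "{k}" "\<lambda>_. {..1}"] by (simp add: Int_absorb2)
    then show "AE \<omega> in lim_space. snd \<omega> k \<le> 1"
      using borel_measurable_le[OF measurable_lim_space_U borel_measurable_const, of k 1]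
      by (subst (asm) prob_Collect_eq_1) auto
  next
    fix k :: nat and e :: real assume e: "0 < e" "e \<le> 1"
    have "{0..1} \<inter> {..e} = {0..e}" using e by auto
    then show "prob {\<omega>\<in>space lim_space. snd \<omega> k \<le> e} \<le> e"
      using measure_lim_space_cylinder[of "{}" "{k}" "\<lambda>_. {..e}"] e by simp
  next
    fix k p j :: nat assume p: "prime p"
    show "prob {\<omega>\<in>space lim_space. j \<le> fst \<omega> (k, p)} \<le> 1 / real p ^ j"
      using measure_lim_space_cylinder[of "{(k, p)}" "{}" "\<lambda>_. {}" "\<lambda>_. {j..}"] measure_geometric_atLeast[OF p, of j] p by simp
  next
    fix k l p :: nat assume kl: "k \<noteq> l" and p: "prime p"
    show "prob {\<omega>\<in>space lim_space. 1 \<le> fst \<omega> (k, p) \<and> 1 \<le> fst \<omega> (l, p)} \<le> 1 / real p ^ 2"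
      using measure_lim_space_cylinder[of "{(k, p), (l, p)}" "{}" "\<lambda>_. {}" "\<lambda>_. {1..}"] measure_geometric_atLeast[OF p, of 1] p kl
      by (simp add: power2_eq_square)
  qed
qed

section \<open>Convergence of the joint event probabilities\<close>

text \<open>The strongest of the level conditions that \<open>J\<close> puts on index
  \<open>k\<close>. The inserted 1 is the value when there are none, and it also encodes that ratios
  do not exceed 1.\<close>

definition level_cap :: "nat \<Rightarrow> event_index set \<Rightarrow> nat \<Rightarrow> real" where
  "level_cap N J k = Min (insert 1 ((\<lambda>a. real a / real (N^2)) ` {a. Inl (k, a) \<in> J}))"

text \<open>The inserted 0 is the trivial requirement, used when \<open>J\<close> says nothing about
  \<open>k\<close> and \<open>p\<close>.\<close>

definition min_exponent :: "event_index set \<Rightarrow> nat \<Rightarrow> nat \<Rightarrow> nat" where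
  "min_exponent J k p = Max (insert 0 {j. Inr (k, p, j) \<in> J})"

lemma finite_index_sections:
  fixes J :: "event_index set"
  assumes "finite J"
  shows "finite {a. Inl (k, a) \<in> J}" "finite {j. Inr (k, p, j) \<in> J}"
  using finite_vimageI[OF assms, of "\<lambda>a. Inl (k, a)"] finite_vimageI[OF assms, of "\<lambda>j. Inr (k, p, j)"]
  by (auto simp: vimage_def inj_def)

lemma level_cap_ge_iff:
  assumes "finite J" "t \<le> 1"
  shows "t \<le> level_cap N J k \<longleftrightarrow> (\<forall>a. Inl (k, a) \<in> J \<longrightarrow> t \<le> real a / real (N^2))"
  unfolding level_cap_def using assms finite_index_sections(1)[OF assms(1), of k]
  by (subst Min_ge_iff) auto

lemma level_cap_bounds:
  assumes "finite J"
  shows "0 \<le> level_cap N J k" "level_cap N J k \<le> 1"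
  unfolding level_cap_def using assms finite_index_sections(1)[OF assms(1), of k]
  by (auto intro!: Min_le)

lemma min_exponent_le_iff:
  assumes "finite J"
  shows "min_exponent J k p \<le> w \<longleftrightarrow> (\<forall>j. Inr (k, p, j) \<in> J \<longrightarrow> j \<le> w)"
  unfolding min_exponent_def using assms finite_index_sections(2)[OF assms(1), of k p]
  by (subst Max_le_iff) auto

text \<open>Powers of distinct primes are coprime, so dividing by all of them amounts to dividing by
  their product. This merges the conditions at several primes into a single divisor.\<close>

lemma prod_prime_powers_dvd_iff:
  assumes "finite S" "\<And>p. p \<in> S \<Longrightarrow> prime (p::nat)" "u > 0"
  shows "(\<Prod>p\<in>S. p ^ e p) dvd u \<longleftrightarrow> (\<forall>p\<in>S. e p \<le> multiplicity p u)"
proof -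
  have "(\<Prod>p\<in>S. p ^ e p) dvd u \<longleftrightarrow> (\<forall>p\<in>S. p ^ e p dvd u)"
    using assms(1,2)
  proof (induction S rule: finite_induct)
    case (insert q S)
    have "coprime (q ^ e q) (\<Prod>p\<in>S. p ^ e p)"
      using insert by (intro prod_coprime_right coprime_power_left_iff[THEN iffD2] coprime_power_right_iff[THEN iffD2] disjI1 primes_coprime) auto
    then have "q ^ e q * (\<Prod>p\<in>S. p ^ e p) dvd u \<longleftrightarrow> q ^ e q dvd u \<and> (\<Prod>p\<in>S. p ^ e p) dvd u"
      by (meson divides_mult dvd_mult_left dvd_mult_right)
    with insert show ?case by simp
  qed simp
  with assms show ?thesis by (simp add: le_multiplicity_iff_dvd)
qed

text \<open>Sorts the conditions in \<open>J\<close> by index \<open>k\<close>, the form to which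
  independence applies. The level conditions are not yet merged into \<open>level_cap\<close>, since
  that needs \<open>x k \<le> 1\<close>.\<close>

lemma basic_event_all_iff:
  assumes J: "J \<subseteq> event_indices M N"
  shows "(\<forall>s\<in>J. basic_event N x v s) \<longleftrightarrow>
    (\<forall>k\<in>{1..M}. (\<forall>a. Inl (k, a) \<in> J \<longrightarrow> x k \<le> real a / real (N^2)) \<and>
       (\<forall>p\<in>{p. prime p \<and> p \<le> N}. min_exponent J k p \<le> v k p))" (is "?l \<longleftrightarrow> ?r")
proof -
  have fin: "finite J" using finite_subset[OF J] by simp
  have "?r \<longleftrightarrow> (\<forall>k\<in>{1..M}. (\<forall>a. Inl (k, a) \<in> J \<longrightarrow> x k \<le> real a / real (N^2)) \<and>
       (\<forall>p\<in>{p. prime p \<and> p \<le> N}. \<forall>j. Inr (k, p, j) \<in> J \<longrightarrow> j \<le> v k p))"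
    by (simp only: min_exponent_le_iff[OF fin])
  also have "\<dots> \<longleftrightarrow> (\<forall>k a. Inl (k, a) \<in> J \<longrightarrow> x k \<le> real a / real (N^2)) \<and> (\<forall>k p j. Inr (k, p, j) \<in> J \<longrightarrow> j \<le> v k p)"
  proof -
    have "k \<in> {1..M}" if "Inl (k, a) \<in> J" for k a
      using subsetD[OF J that] by (auto simp: event_indices_def)
    moreover have "k \<in> {1..M} \<and> p \<in> {p. prime p \<and> p \<le> N}" if "Inr (k, p, j) \<in> J" for k p j
      using subsetD[OF J that] by (auto simp: event_indices_def)
    ultimately show ?thesis by blast
  qed
  also have "\<dots> \<longleftrightarrow> ?l"
  proof
    assume *: "(\<forall>k a. Inl (k, a) \<in> J \<longrightarrow> x k \<le> real a / real (N^2)) \<and> (\<forall>k p j. Inr (k, p, j) \<in> J \<longrightarrow> j \<le> v k p)"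
    show ?l
    proof
      fix s assume "s \<in> J"
      then show "basic_event N x v s" using *
        by (cases "(N, x, v, s)" rule: basic_event.cases) auto
    qed
  qed force
  finally show ?thesis by simp
qed

text \<open>The floor loses at most 1 before the division by \<open>d\<close> and the integer
  division at most 1 more; both losses vanish after division by \<open>n\<close>.\<close>

lemma floor_div_tendsto:
  assumes "0 \<le> b" "d > 0"
  shows "(\<lambda>n. real (nat \<lfloor>b * real n\<rfloor> div d) / real n) \<longlonglongrightarrow> b / real d"
proof (rule tendsto_sandwich)
  show "\<forall>\<^sub>F n in sequentially. b / real d - (1 / real d + 1) * (1 / real n) \<le> real (nat \<lfloor>b * real n\<rfloor> div d) / real n"
  proof (rule eventually_sequentiallyI[of 1])
    fix n :: nat assume n: "1 \<le> n"
    have "b * real n - 1 \<le> real (nat \<lfloor>b * real n\<rfloor>)" using assms by linarith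
    then have "(b * real n - 1) / real d \<le> real (nat \<lfloor>b * real n\<rfloor>) / real d" by (rule divide_right_mono) simp
    also have "\<dots> \<le> real (nat \<lfloor>b * real n\<rfloor> div d) + 1"
    proof -
      have "nat \<lfloor>b * real n\<rfloor> \<le> d * (nat \<lfloor>b * real n\<rfloor> div d) + d"
        using dividend_less_times_div[OF assms(2)] by (simp add: less_imp_le add.commute)
      then have "real (nat \<lfloor>b * real n\<rfloor>) \<le> real (d * (nat \<lfloor>b * real n\<rfloor> div d) + d)" by (rule of_nat_mono)
      then show ?thesis using assms(2) by (simp add: field_simps)
    qed
    finally have "((b * real n - 1) / real d - 1) / real n \<le> real (nat \<lfloor>b * real n\<rfloor> div d) / real n"
      by (intro divide_right_mono) auto
    then show "b / real d - (1 / real d + 1) * (1 / real n) \<le> real (nat \<lfloor>b * real n\<rfloor> div d) / real n"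
      using n assms by (simp add: field_simps)
  qed
  show "\<forall>\<^sub>F n in sequentially. real (nat \<lfloor>b * real n\<rfloor> div d) / real n \<le> b / real d"
  proof (rule eventually_sequentiallyI[of 1])
    fix n :: nat assume n: "1 \<le> n"
    have "real (nat \<lfloor>b * real n\<rfloor> div d) \<le> real (nat \<lfloor>b * real n\<rfloor>) / real d" by (rule of_nat_div_le_of_nat)
    also have "\<dots> \<le> b * real n / real d" using assms by (intro divide_right_mono) auto
    finally show "real (nat \<lfloor>b * real n\<rfloor> div d) / real n \<le> b / real d" using n assms by (simp add: field_simps)
  qed
  have "(\<lambda>n. b / real d - (1 / real d + 1) * (1 / real n)) \<longlonglongrightarrow> b / real d - (1 / real d + 1) * 0"
    by (intro tendsto_intros lim_1_over_n)
  then show "(\<lambda>n. b / real d - (1 / real d + 1) * (1 / real n)) \<longlonglongrightarrow> b / real d" by simp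
qed auto

text \<open>For each \<open>k\<close> the events in \<open>J\<close> ask a draw to be at most
  \<open>level_cap * n\<close> and divisible by \<open>d k\<close>, so its probability is a count of
  multiples divided by \<open>n\<close>. The limit separates into an interval length and
  \<open>1 / d k\<close>; here size and valuations become asymptotically independent.\<close>

lemma basic_events_prob_tendsto:
  assumes J: "J \<subseteq> event_indices M N"
  shows "(\<lambda>n. measure (U_space n) {\<omega>\<in>space (U_space n). \<forall>s\<in>J. basic_event N (\<lambda>k. real (\<omega> k) / real n) (\<lambda>k p. multiplicity p (\<omega> k)) s})
    \<longlonglongrightarrow> measure lim_space {\<omega>\<in>space lim_space. \<forall>s\<in>J. basic_event N (\<lambda>k. snd \<omega> k) (\<lambda>k p. fst \<omega> (k, p)) s}"
proof -
  let ?PN = "{p. prime p \<and> p \<le> N}"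
  define d where "d k = (\<Prod>p\<in>?PN. p ^ min_exponent J k p)" for k
  have fin: "finite J" using finite_subset[OF J] by simp
  have d: "d k > 0" for k unfolding d_def by (intro prod_pos) (auto simp: prime_gt_0_nat)
  have U: "measure (U_space n) {\<omega>\<in>space (U_space n). \<forall>s\<in>J. basic_event N (\<lambda>k. real (\<omega> k) / real n) (\<lambda>k p. multiplicity p (\<omega> k)) s}
    = (\<Prod>k\<in>{1..M}. real (nat \<lfloor>level_cap N J k * real n\<rfloor> div d k) / real n)" if n: "n > 0" for n
  proof -
    let ?A = "\<lambda>k. {u. (\<forall>a. Inl (k, a) \<in> J \<longrightarrow> real u / real n \<le> real a / real (N^2)) \<and> (\<forall>p\<in>?PN. min_exponent J k p \<le> multiplicity p u)}"
    have "{1..n} \<inter> ?A k = {u\<in>{1..nat \<lfloor>level_cap N J k * real n\<rfloor>}. d k dvd u}" for k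
    proof (rule set_eqI)
      fix u
      \<comment> \<open>The condition \<open>u \<le> n\<close> is what the default 1 in
        \<open>level_cap\<close> stands for.\<close>
      have *: "u \<le> n \<and> (\<forall>a. Inl (k, a) \<in> J \<longrightarrow> real u / real n \<le> real a / real (N^2)) \<longleftrightarrow> u \<le> nat \<lfloor>level_cap N J k * real n\<rfloor>"
      proof -
        have "u \<le> nat \<lfloor>level_cap N J k * real n\<rfloor> \<longleftrightarrow> real u \<le> level_cap N J k * real n"
          using level_cap_bounds(1)[OF fin] by (simp add: le_nat_iff le_floor_iff)
        also have "\<dots> \<longleftrightarrow> real u / real n \<le> level_cap N J k" using n by (simp add: field_simps)
        also have "\<dots> \<longleftrightarrow> real u / real n \<le> 1 \<and> real u / real n \<le> level_cap N J k"
          using level_cap_bounds(2)[OF fin, of N k] by auto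
        also have "\<dots> \<longleftrightarrow> real u / real n \<le> 1 \<and> (\<forall>a. Inl (k, a) \<in> J \<longrightarrow> real u / real n \<le> real a / real (N^2))"
          using level_cap_ge_iff[OF fin] by blast
        finally show ?thesis using n by (simp add: field_simps)
      qed
      have "d k dvd u \<longleftrightarrow> (\<forall>p\<in>?PN. min_exponent J k p \<le> multiplicity p u)" if "u > 0"
        unfolding d_def using that by (intro prod_prime_powers_dvd_iff) auto
      with * show "u \<in> {1..n} \<inter> ?A k \<longleftrightarrow> u \<in> {u\<in>{1..nat \<lfloor>level_cap N J k * real n\<rfloor>}. d k dvd u}"
        by (auto simp del: of_nat_power)
    qed
    then have "card ({1..n} \<inter> ?A k) = nat \<lfloor>level_cap N J k * real n\<rfloor> div d k" for k
      by (simp only: card_dvd_upto[OF d])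
    then show ?thesis
      using measure_U_space_cylinder[OF n, of "{1..M}" ?A] unfolding basic_event_all_iff[OF J] by simp
  qed
  \<comment> \<open>The uniform variable contributes the length \<open>level_cap\<close> of an
    interval, and the geometric tails \<open>1 / p ^ min_exponent\<close> multiply to
    \<open>1 / d k\<close>.\<close>
  have L: "measure lim_space {\<omega>\<in>space lim_space. \<forall>s\<in>J. basic_event N (\<lambda>k. snd \<omega> k) (\<lambda>k p. fst \<omega> (k, p)) s}
    = (\<Prod>k\<in>{1..M}. level_cap N J k / real (d k))"
  proof -
    let ?A = "\<lambda>(k, p). {min_exponent J k p..}"
    let ?B = "\<lambda>k. {t. \<forall>a. Inl (k, a) \<in> J \<longrightarrow> t \<le> real a / real (N^2)}"
    have B: "?B k \<in> sets borel" for k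
      by measurable
    have "{0..1} \<inter> ?B k = {0..level_cap N J k}" for k
    proof (rule set_eqI)
      fix t
      have "t \<in> {0..1} \<inter> ?B k \<longleftrightarrow> 0 \<le> t \<and> t \<le> 1 \<and> t \<le> level_cap N J k"
        using level_cap_ge_iff[OF fin, of t N k] by auto
      then show "t \<in> {0..1} \<inter> ?B k \<longleftrightarrow> t \<in> {0..level_cap N J k}"
        using level_cap_bounds[OF fin, of N k] by auto
    qed
    then have lB: "measure lborel ({0..1} \<inter> ?B k) = level_cap N J k" for k
      using level_cap_bounds[OF fin, of N k] by simp
    have "measure lim_space {\<omega>\<in>space lim_space. \<forall>s\<in>J. basic_event N (\<lambda>k. snd \<omega> k) (\<lambda>k p. fst \<omega> (k, p)) s}
      = measure lim_space {\<omega>. (\<forall>i\<in>{1..M} \<times> ?PN. fst \<omega> i \<in> ?A i) \<and> (\<forall>k\<in>{1..M}. snd \<omega> k \<in> ?B k)}"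
      unfolding basic_event_all_iff[OF J] by (intro arg_cong[of _ _ "measure lim_space"]) auto
    also have "\<dots> = (\<Prod>i\<in>{1..M} \<times> ?PN. measure (measure_pmf (if prime (snd i) then geometric_pmf (1 - 1 / real (snd i)) else return_pmf 0)) (?A i)) *
        (\<Prod>k\<in>{1..M}. measure lborel ({0..1} \<inter> ?B k))"
      using B by (intro measure_lim_space_cylinder) auto
    also have "(\<Prod>i\<in>{1..M} \<times> ?PN. measure (measure_pmf (if prime (snd i) then geometric_pmf (1 - 1 / real (snd i)) else return_pmf 0)) (?A i))
      = (\<Prod>(k, p)\<in>{1..M} \<times> ?PN. 1 / real p ^ min_exponent J k p)"
      by (intro prod.cong refl) (auto simp: measure_geometric_atLeast)
    also have "\<dots> = (\<Prod>k\<in>{1..M}. 1 / real (d k))"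
      unfolding prod.cartesian_product[symmetric] d_def by (simp add: prod_dividef)
    finally show ?thesis unfolding lB by (simp add: prod_dividef)
  qed
  have "(\<lambda>n. \<Prod>k\<in>{1..M}. real (nat \<lfloor>level_cap N J k * real n\<rfloor> div d k) / real n) \<longlonglongrightarrow> (\<Prod>k\<in>{1..M}. level_cap N J k / real (d k))"
    by (intro tendsto_prod floor_div_tendsto level_cap_bounds fin d)
  then show ?thesis unfolding L
    by (rule Lim_transform_eventually) (use U in \<open>auto intro!: eventually_sequentiallyI[of 1]\<close>)
qed

section \<open>The random least common multiple\<close>

text \<open>As a list, a finite prefix of the draws lies in a countable type with the discrete
  sigma-algebra. Afterwards every function of the prefix, such as a cardinality or an lcm, is
  measurable.\<close>

lemma measurable_U_space_prefix:
  "(\<lambda>\<omega>. map \<omega> [1..<Suc j]) \<in> measurable (U_space n) (count_space UNIV)"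
proof (induction j)
  case (Suc j)
  have "(\<lambda>\<omega>. (map \<omega> [1..<Suc j], \<omega> (Suc j))) \<in> measurable (U_space n) (count_space UNIV \<Otimes>\<^sub>M count_space UNIV)"
    by (rule measurable_Pair[OF Suc measurable_U_space_coordinate])
  then have "(\<lambda>\<omega>. (map \<omega> [1..<Suc j], \<omega> (Suc j))) \<in> measurable (U_space n) (count_space UNIV)"
    by (simp add: pair_measure_countable)
  from measurable_compose[OF this, of "\<lambda>(xs, x). xs @ [x]" "count_space UNIV"]
  show ?case by simp
qed simp

lemma measurable_U_space_prefix_image:
  "(\<lambda>\<omega>. f (\<omega> ` {1..j})) \<in> measurable (U_space n) (count_space UNIV)"
proof -
  have "(\<lambda>\<omega>. f (set (map \<omega> [1..<Suc j]))) \<in> measurable (U_space n) (count_space UNIV)"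
    by (rule measurable_compose[OF measurable_U_space_prefix]) simp
  moreover have "set (map \<omega> [1..<Suc j]) = \<omega> ` {1..j}" for \<omega> :: "nat \<Rightarrow> nat"
    by (simp only: set_map set_upt atLeastLessThanSuc_atLeastAtMost)
  ultimately show ?thesis by simp
qed

lemma measurable_tau: "tau n m \<in> measurable (U_space n) (count_space UNIV)"
  unfolding tau_def by (intro measurable_Least measurable_U_space_prefix_image)

text \<open>The prefix has random length \<open>tau\<close>; measurability follows by splitting over
  its countably many values.\<close>

lemma borel_measurable_X: "X n \<in> borel_measurable (U_space n)"
proof (rule measurable_coordinatewise_then_product)
  fix i
  have "(\<lambda>\<omega>. Lcm (\<omega> ` {1..tau n (Suc i) \<omega>})) \<in> measurable (U_space n) (count_space UNIV)"
    by (rule measurable_compose_countable[OF measurable_U_space_prefix_image measurable_tau])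
  then have "(\<lambda>\<omega>. ln (real (Lcm (B n (Suc i) \<omega>))) - real (Suc i) * ln (real n)) \<in> borel_measurable (U_space n)"
    unfolding B_def by (rule measurable_compose) simp
  then show "(\<lambda>\<omega>. X n \<omega> i) \<in> borel_measurable (U_space n)"
    by (simp add: X_def Let_def)
qed

lemma borel_measurable_Y: "Y \<in> borel_measurable lim_space"
  using borel_measurable_arith_functional[where P = lim_space, OF measurable_lim_space_U measurable_lim_space_G]
  by (simp add: Y_eq_arith_functional[abs_def])

section \<open>Reduction to distinct draws\<close>

text \<open>As long as the draws are distinct each one adds a new value, so the count first reaches
  \<open>m\<close> at time \<open>m\<close>.\<close>

lemma tau_eq:
  assumes "inj_on \<omega> {1..M}" "m \<le> M" "M \<le> n"
  shows "tau n m \<omega> = m"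
proof -
  have "card (\<omega> ` {1..j}) = j" if "j \<le> m" for j
    using card_image[OF inj_on_subset[OF assms(1)], of "{1..j}"] that assms(2) by simp
  then show ?thesis unfolding tau_def using assms(2,3)
    by (intro Least_equality) (auto simp: min_def, metis nat_le_linear)
qed

lemma X_eq_arith_functional:
  assumes inj: "inj_on \<omega> {1..M}" and range: "\<And>k. k \<in> {1..M} \<Longrightarrow> \<omega> k \<in> {1..n}"
    and "i < M" "M \<le> n"
  shows "X n \<omega> i = arith_functional (\<lambda>k. real (\<omega> k) / real n) (\<lambda>k p. multiplicity p (\<omega> k)) i"
proof -
  have "tau n (Suc i) \<omega> = Suc i" using assms by (intro tau_eq[OF inj]) auto
  then have "X n \<omega> i = ln (real (Lcm (\<omega> ` {1..Suc i}))) - real (Suc i) * ln (real n)"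
    by (simp add: X_def B_def Let_def)
  also have "\<dots> = arith_functional (\<lambda>k. real (\<omega> k) / real n) (\<lambda>k p. multiplicity p (\<omega> k)) i"
  proof (rule ln_Lcm_eq_arith_functional)
    show "0 < \<omega> k" if "k \<in> {1..Suc i}" for k using range[of k] that assms(3) by auto
  qed (use assms in auto)
  finally show ?thesis .
qed

text \<open>Almost surely the common value is one of \<open>n\<close> numbers, and each is hit by
  both draws with probability \<open>1 / n^2\<close>.\<close>

lemma prob_coincidence_le:
  assumes n: "n > 0" and kl: "k \<noteq> l"
  shows "measure (U_space n) {\<omega>. \<omega> k = \<omega> l} \<le> 1 / real n"
proof -
  interpret prob_space "U_space n" by (rule prob_space_U_space)
  have m: "{\<omega>. \<omega> k = u \<and> \<omega> l = u} \<in> events" for u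
  proof -
    have "(\<lambda>\<omega>. \<omega> k = u \<and> \<omega> l = u) \<in> measurable (U_space n) (count_space UNIV)"
      by (intro pred_intros_logic measurable_U_space_compose)
    then show ?thesis by (simp add: pred_def)
  qed
  have "prob {\<omega>. \<omega> k = \<omega> l} \<le> prob (\<Union>u\<in>{1..n}. {\<omega>. \<omega> k = u \<and> \<omega> l = u})"
  proof (rule finite_measure_mono_AE)
    show "AE \<omega> in U_space n. \<omega> \<in> {\<omega>. \<omega> k = \<omega> l} \<longrightarrow> \<omega> \<in> (\<Union>u\<in>{1..n}. {\<omega>. \<omega> k = u \<and> \<omega> l = u})"
      using AE_U_space[OF n, of k] by eventually_elim auto
  qed (use m in auto)
  also have "\<dots> \<le> (\<Sum>u\<in>{1..n}. prob {\<omega>. \<omega> k = u \<and> \<omega> l = u})"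
    using m by (intro finite_measure_subadditive_finite) auto
  also have "\<dots> = (\<Sum>u\<in>{1..n}. 1 / real n * (1 / real n))"
  proof (rule sum.cong[OF refl])
    fix u assume "u \<in> {1..n}"
    then have "card ({1..n} \<inter> {u}) = 1" by simp
    then show "prob {\<omega>. \<omega> k = u \<and> \<omega> l = u} = 1 / real n * (1 / real n)"
      using measure_U_space_cylinder[OF n, of "{k, l}" "\<lambda>_. {u}"] kl by simp
  qed
  also have "\<dots> = 1 / real n" using n by simp
  finally show ?thesis .
qed

lemma prob_not_distinct_le:
  assumes n: "n > 0"
  shows "{\<omega>. \<not> inj_on \<omega> {1..M}} \<in> sets (U_space n)"
    and "measure (U_space n) {\<omega>. \<not> inj_on \<omega> {1..M}} \<le> real M ^ 2 / real n"
proof -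
  interpret prob_space "U_space n" by (rule prob_space_U_space)
  \<comment> \<open>Diagonal pairs get the empty event, so the union can run over the full square of
    indices.\<close>
  let ?C = "\<lambda>kl. if fst kl = snd kl then {} else {\<omega>::nat \<Rightarrow> nat. \<omega> (fst kl) = \<omega> (snd kl)}"
  have m: "{\<omega>. \<omega> k = \<omega> l} \<in> events" for k l
  proof -
    have "(\<lambda>\<omega>. \<omega> k = \<omega> l) \<in> measurable (U_space n) (count_space UNIV)"
      using measurable_U_space_coordinate[of k n] measurable_U_space_coordinate[of l n] by measurable
    then show ?thesis by (simp add: pred_def)
  qed
  have eq: "{\<omega>. \<not> inj_on \<omega> {1..M}} = (\<Union>kl\<in>{1..M} \<times> {1..M}. ?C kl)"
  proof (intro equalityI subsetI)
    fix \<omega> :: "nat \<Rightarrow> nat" assume "\<omega> \<in> {\<omega>. \<not> inj_on \<omega> {1..M}}"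
    then obtain k l where "k \<in> {1..M}" "l \<in> {1..M}" "k \<noteq> l" "\<omega> k = \<omega> l" by (auto simp: inj_on_def)
    then show "\<omega> \<in> (\<Union>kl\<in>{1..M} \<times> {1..M}. ?C kl)" by (intro UN_I[of "(k, l)"]) auto
  next
    fix \<omega> :: "nat \<Rightarrow> nat" assume "\<omega> \<in> (\<Union>kl\<in>{1..M} \<times> {1..M}. ?C kl)"
    then obtain k l where kl: "k \<in> {1..M}" "l \<in> {1..M}" "\<omega> \<in> ?C (k, l)" by blast
    then have "k \<noteq> l \<and> \<omega> k = \<omega> l" by (cases "k = l") auto
    with kl(1,2) show "\<omega> \<in> {\<omega>. \<not> inj_on \<omega> {1..M}}" unfolding inj_on_def by blast
  qed
  show "{\<omega>. \<not> inj_on \<omega> {1..M}} \<in> events"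
    unfolding eq using m by (intro sets.finite_UN) auto
  have "prob (\<Union>kl\<in>{1..M} \<times> {1..M}. ?C kl) \<le> (\<Sum>kl\<in>{1..M} \<times> {1..M}. prob (?C kl))"
    using m by (intro finite_measure_subadditive_finite) auto
  also have "\<dots> \<le> (\<Sum>kl\<in>{1..M} \<times> {1..M}. 1 / real n)"
    using prob_coincidence_le[OF n] by (intro sum_mono) auto
  also have "\<dots> = real M ^ 2 / real n" by (simp add: card_cartesian_product power2_eq_square)
  finally show "prob {\<omega>. \<not> inj_on \<omega> {1..M}} \<le> real M ^ 2 / real n" unfolding eq .
qed

text \<open>Without repetitions among the first \<open>M\<close> draws the two arguments of
  \<open>h\<close> agree in the first \<open>M\<close> coordinates; a repetition costs at most
  \<open>2 * C\<close> and has the probability bounded in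
  \<open>prob_not_distinct_le\<close>.\<close>

lemma expectation_X_close:
  assumes n: "n > 0" "M \<le> n" and h: "h \<in> borel_measurable borel" "\<And>y. \<bar>h y\<bar> \<le> C"
    and lip: "\<And>y z. \<bar>h y - h z\<bar> \<le> L * (\<Sum>i<M. \<bar>y i - z i\<bar>)"
  shows "\<bar>integral\<^sup>L (U_space n) (\<lambda>\<omega>. h (X n \<omega>)) -
     integral\<^sup>L (U_space n) (\<lambda>\<omega>. h (arith_functional (\<lambda>k. real (\<omega> k) / real n) (\<lambda>k p. multiplicity p (\<omega> k))))\<bar>
    \<le> 2 * C * (real M ^ 2 / real n)"
proof -
  interpret valuation_model "U_space n" "\<lambda>k \<omega>. real (\<omega> k) / real n" "\<lambda>k p \<omega>. multiplicity p (\<omega> k)"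
    by (rule valuation_model_U_space[OF n(1)])
  let ?f = "\<lambda>\<omega>. h (X n \<omega>)"
  let ?g = "\<lambda>\<omega>. h (arith_functional (\<lambda>k. real (\<omega> k) / real n) (\<lambda>k p. multiplicity p (\<omega> k)))"
  let ?D = "{\<omega>::nat \<Rightarrow> nat. \<not> inj_on \<omega> {1..M}}"
  have C: "0 \<le> C" using h(2)[of undefined] by linarith
  have f: "integrable (U_space n) ?f"
    by (rule integrable_const_bound[of _ C]) (use h in \<open>auto intro: measurable_compose[OF borel_measurable_X]\<close>)
  have g: "integrable (U_space n) ?g"
    by (rule integrable_const_bound[of _ C])
      (use h in \<open>auto intro!: measurable_compose[OF borel_measurable_arith_functional[OF x_measurable v_measurable]]\<close>)
  have "\<bar>expectation ?f - expectation ?g\<bar> = \<bar>expectation (\<lambda>\<omega>. ?f \<omega> - ?g \<omega>)\<bar>" using f g by simp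
  also have "\<dots> \<le> expectation (\<lambda>\<omega>. \<bar>?f \<omega> - ?g \<omega>\<bar>)" by (rule integral_abs_bound)
  also have "\<dots> \<le> expectation (\<lambda>\<omega>. 2 * C * indicat_real ?D \<omega>)"
  proof (rule integral_mono_AE)
    have "AE \<omega> in U_space n. \<forall>k\<in>{1..M}. \<omega> k \<in> {1..n}"
      using AE_U_space[OF n(1)] by (intro AE_finite_allI) auto
    then show "AE \<omega> in U_space n. \<bar>?f \<omega> - ?g \<omega>\<bar> \<le> 2 * C * indicat_real ?D \<omega>"
    proof eventually_elim
      case (elim \<omega>)
      let ?y = "arith_functional (\<lambda>k. real (\<omega> k) / real n) (\<lambda>k p. multiplicity p (\<omega> k))"
      show ?case
      proof (cases "\<omega> \<in> ?D")
        case True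
        have "\<bar>h (X n \<omega>) - h ?y\<bar> \<le> 2 * C" using h(2)[of "X n \<omega>"] h(2)[of ?y] by linarith
        then show ?thesis using True by simp
      next
        case False
        then have "X n \<omega> i = ?y i" if "i < M" for i
          using elim that n by (intro X_eq_arith_functional) auto
        \<comment> \<open>Distance zero in the first \<open>M\<close> coordinates forces equal
          values of \<open>h\<close> by the Lipschitz bound, whatever the other coordinates
          are.\<close>
        then have "(\<Sum>i<M. \<bar>X n \<omega> i - ?y i\<bar>) = 0" by simp
        then show ?thesis using lip[of "X n \<omega>" ?y] False by simp
      qed
    qed
  qed (use f g prob_not_distinct_le(1)[OF n(1), of M] in \<open>auto simp: emeasure_eq_measure\<close>)
  also have "\<dots> = 2 * C * prob ?D" by simp
  also have "\<dots> \<le> 2 * C * (real M ^ 2 / real n)"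
    using prob_not_distinct_le(2)[OF n(1), of M] C by (intro mult_left_mono) auto
  finally show ?thesis .
qed

section \<open>Interchange of limits and conclusion\<close>

text \<open>The error \<open>e N\<close> does not depend on \<open>n\<close>, so \<open>N\<close>
  can be fixed first and \<open>n\<close> sent to infinity afterwards.\<close>

lemma tendsto_uniform_approximation:
  fixes a :: "nat \<Rightarrow> real"
  assumes ab: "\<And>n N. n \<ge> n0 \<Longrightarrow> N > 0 \<Longrightarrow> \<bar>a n - b N n\<bar> \<le> e N + f n"
    and b: "\<And>N. N > 0 \<Longrightarrow> b N \<longlonglongrightarrow> c N" and c: "\<And>N. N > 0 \<Longrightarrow> \<bar>c N - l\<bar> \<le> e N"
    and e: "e \<longlonglongrightarrow> 0" and f: "f \<longlonglongrightarrow> 0"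
  shows "a \<longlonglongrightarrow> l"
proof (rule tendstoI)
  \<comment> \<open>Four quarters of \<open>r\<close>: \<open>e N\<close> is spent twice, for
    \<open>a\<close> against \<open>b N\<close> and for \<open>c N\<close> against \<open>l\<close>,
    and \<open>f n\<close> and the distance from \<open>b N n\<close> to \<open>c N\<close> once
    each.\<close>
  fix r :: real assume r: "r > 0"
  have "\<forall>\<^sub>F N in sequentially. e N < r / 4" using order_tendstoD(2)[OF e, of "r / 4"] r by simp
  then obtain N where N: "N > 0" "e N < r / 4"
    using eventually_conj[OF _ eventually_gt_at_top[of 0]] eventually_happens'[OF sequentially_bot] by (metis (mono_tags, lifting))
  have "\<forall>\<^sub>F n in sequentially. dist (b N n) (c N) < r / 4" using tendstoD[OF b[OF N(1)], of "r / 4"] r by simp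
  moreover have "\<forall>\<^sub>F n in sequentially. f n < r / 4" using order_tendstoD(2)[OF f, of "r / 4"] r by simp
  ultimately show "\<forall>\<^sub>F n in sequentially. dist (a n) l < r"
    using eventually_ge_at_top[of n0]
  proof eventually_elim
    case (elim n)
    then show ?case using ab[of n N] c[of N] N unfolding dist_real_def by linarith
  qed
qed

lemma truncation_bound_tendsto_0:
  "(\<lambda>N. L * (real M * (real M / real N)) + 2 * C * (real M / real N + real M * real N * (1 / 2 ^ Suc N)
      + real M ^ 2 * (\<Sum>q. 1 / real (q + Suc N) ^ 2))) \<longlonglongrightarrow> 0"
proof -
  \<comment> \<open>The term at \<open>q = 0\<close> is \<open>1 / 0 = 0\<close>; the series is
    otherwise that of the inverse squares.\<close>
  let ?s = "\<lambda>q. 1 / real q ^ 2"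
  have sm: "summable ?s"
    using inverse_power_summable[of 2, where 'a=real] by (simp add: inverse_eq_divide)
  have "(\<lambda>N. suminf ?s - (\<Sum>q<Suc N. ?s q)) \<longlonglongrightarrow> suminf ?s - suminf ?s"
    by (intro tendsto_intros LIMSEQ_Suc[OF summable_LIMSEQ[OF sm]])
  then have tail: "(\<lambda>N. \<Sum>q. ?s (q + Suc N)) \<longlonglongrightarrow> 0"
    unfolding suminf_minus_initial_segment[OF sm] by simp
  have "(\<lambda>N. real N * (1/2) ^ N) \<longlonglongrightarrow> 0"
    using powser_times_n_limit_0[of "1/2 :: real"] by simp
  then have geo: "(\<lambda>N. 1/2 * (real N * (1/2) ^ N)) \<longlonglongrightarrow> 1/2 * 0" by (intro tendsto_intros)
  have "(\<lambda>N. L * (real M * (real M * (1 / real N))) + 2 * C * (real M * (1 / real N) + real M * (1/2 * (real N * (1/2) ^ N))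
      + real M ^ 2 * (\<Sum>q. ?s (q + Suc N)))) \<longlonglongrightarrow>
     L * (real M * (real M * 0)) + 2 * C * (real M * 0 + real M * (1/2 * 0) + real M ^ 2 * 0)"
    by (intro tendsto_intros lim_1_over_n tail geo)
  then show ?thesis by (simp add: power_divide field_simps)
qed

theorem theorem3p4:
  shows "conv_in_distr (\<lambda>n. distr (U_space n) borel (X n)) (distr lim_space borel Y)"
proof (rule conv_in_distrI_lipschitz)
  fix n
  interpret prob_space "U_space n" by (rule prob_space_U_space)
  show "prob_space (distr (U_space n) borel (X n))" by (rule prob_space_distr[OF borel_measurable_X])
  show "sets (distr (U_space n) borel (X n)) = sets borel" by simp
next
  interpret prob_space lim_space by (rule prob_space_lim_space)
  show "prob_space (distr lim_space borel Y)" by (rule prob_space_distr[OF borel_measurable_Y])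
  show "sets (distr lim_space borel Y) = sets borel" by simp
next
  fix h :: "(nat \<Rightarrow> real) \<Rightarrow> real" and L M C
  assume lip: "\<And>x y. \<bar>h x - h y\<bar> \<le> L * (\<Sum>i<M. \<bar>x i - y i\<bar>)" and L: "0 \<le> L"
    and C: "\<And>x. \<bar>h x\<bar> \<le> C"
  have h: "h \<in> borel_measurable borel"
    by (intro borel_measurable_continuous_onI coordinate_lipschitz_continuous[OF lip])
  interpret lim: valuation_model lim_space "\<lambda>k \<omega>. snd \<omega> k" "\<lambda>k p \<omega>. fst \<omega> (k, p)"
    by (rule valuation_model_lim_space)
  let ?e = "\<lambda>N. L * (real M * (real M / real N)) + 2 * C * (real M / real N + real M * real N * (1 / 2 ^ Suc N)
      + real M ^ 2 * (\<Sum>q. 1 / real (q + Suc N) ^ 2))"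
  let ?b = "\<lambda>N n. integral\<^sup>L (U_space n) (\<lambda>\<omega>. h (truncated_functional N
      {s\<in>event_indices M N. basic_event N (\<lambda>k. real (\<omega> k) / real n) (\<lambda>k p. multiplicity p (\<omega> k)) s}))"
  let ?c = "\<lambda>N. integral\<^sup>L lim_space (\<lambda>\<omega>. h (truncated_functional N
      {s\<in>event_indices M N. basic_event N (\<lambda>k. snd \<omega> k) (\<lambda>k p. fst \<omega> (k, p)) s}))"
  have "(\<lambda>n. integral\<^sup>L (U_space n) (\<lambda>\<omega>. h (X n \<omega>))) \<longlonglongrightarrow> integral\<^sup>L lim_space (\<lambda>\<omega>. h (Y \<omega>))"
  \<comment> \<open>\<open>?b\<close> and \<open>?c\<close> are the rounded expectations for the
    draws and for the limit variables. Truncation costs \<open>?e N\<close> in either model, and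
    repeated draws cost a term vanishing in \<open>n\<close>.\<close>
  proof (rule tendsto_uniform_approximation[where b = ?b and c = ?c and e = ?e])
    \<comment> \<open>The bound \<open>Suc M\<close> ensures both \<open>M \<le> n\<close> and
      \<open>n > 0\<close>.\<close>
    fix n N :: nat assume n: "n \<ge> Suc M" and N: "N > 0"
    interpret U: valuation_model "U_space n" "\<lambda>k \<omega>. real (\<omega> k) / real n" "\<lambda>k p \<omega>. multiplicity p (\<omega> k)"
      using n by (intro valuation_model_U_space) simp
    show "\<bar>integral\<^sup>L (U_space n) (\<lambda>\<omega>. h (X n \<omega>)) - ?b N n\<bar> \<le> ?e N + 2 * C * (real M ^ 2 / real n)"
      using expectation_X_close[OF _ _ h C lip, of n] U.expectation_truncation_error[OF N h C L lip] n
      unfolding U.profile_def by linarith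
  next
    fix N :: nat assume N: "N > 0"
    show "?b N \<longlonglongrightarrow> ?c N"
    proof (rule expectation_finite_events_tendsto[where g = "\<lambda>S. h (truncated_functional N S)"])
      show "{\<omega>\<in>space (U_space n). basic_event N (\<lambda>k. real (\<omega> k) / real n) (\<lambda>k p. multiplicity p (\<omega> k)) s} \<in> sets (U_space n)" for n s
      proof (cases "n = 0")
        \<comment> \<open>\<open>valuation_model_U_space\<close> does not cover
          \<open>n = 0\<close>, so measurability is derived here directly from the
          coordinates.\<close>
        case True
        have "(\<lambda>\<omega>. basic_event N (\<lambda>k. real (\<omega> k) / real n) (\<lambda>k p. multiplicity p (\<omega> k)) s) \<in> measurable (U_space n) (count_space UNIV)"
          by (cases "(N, \<lambda>k::nat. 0::real, \<lambda>(k::nat) (p::nat). 0::nat, s)" rule: basic_event.cases)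
            (auto intro!: measurable_U_space_compose)
        then show ?thesis by (simp add: pred_def)
      next
        case False
        then interpret U: valuation_model "U_space n" "\<lambda>k \<omega>. real (\<omega> k) / real n" "\<lambda>k p \<omega>. multiplicity p (\<omega> k)"
          by (intro valuation_model_U_space) simp
        show ?thesis by (rule U.basic_event_sets)
      qed
    qed (use prob_space_U_space prob_space_lim_space lim.basic_event_sets basic_events_prob_tendsto in auto)
    show "\<bar>?c N - integral\<^sup>L lim_space (\<lambda>\<omega>. h (Y \<omega>))\<bar> \<le> ?e N"
      using lim.expectation_truncation_error[OF N h C L lip]
      unfolding lim.profile_def Y_eq_arith_functional by linarith
  next
    show "?e \<longlonglongrightarrow> 0" by (rule truncation_bound_tendsto_0)
    have "(\<lambda>n. 2 * C * (real M ^ 2 * (1 / real n))) \<longlonglongrightarrow> 2 * C * (real M ^ 2 * 0)"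
      by (intro tendsto_intros lim_1_over_n)
    then show "(\<lambda>n. 2 * C * (real M ^ 2 / real n)) \<longlonglongrightarrow> 0" by simp
  qed
  then show "(\<lambda>n. integral\<^sup>L (distr (U_space n) borel (X n)) h) \<longlonglongrightarrow> integral\<^sup>L (distr lim_space borel Y) h"
    using h by (simp add: integral_distr borel_measurable_X borel_measurable_Y)
qed

end
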